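(* Let $A\in\mathbb{R}^{m\times n}$ and $b\in\mathbb{R}^m$ be such that $\mathrm{Sym}(\mathrm{ILP}(A,b,\mathbf{1}))$ acts $(\lfloor n/2\rfloor+1)$-transitively on the standard basis of $\mathbb{R}^n$. Then the Core Point Algorithm (described in the context) solves the integer linear program $\mathrm{ILP}(A,b,\mathbf{1})$, that is, it returns an optimal solution if a feasible integer point exists and returns ``infeasible'' otherwise, and it does so in $O(mn^2)$ time.
   Context: $\mathbf{1}\in\mathbb{R}^n$ is the all-ones vector. For $A\in\mathbb{R}^{m\times n}$ without zero rows, $b\in\mathbb{R}^m$ and $c\in\mathbb{R}^n\setminus\{0\}$, let $P(A,b)=\{x\in\mathbb{R}^n : Ax\le b\}$, let $\mathrm{LP}(A,b,c)$ be the linear program $\max\{c^tx : x\in P(A,b)\}$ and let $\mathrm{ILP}(A,b,c)$ be the integer linear program $\max\{c^tx : x\in P(A,b)\cap\mathbb{Z}^n\}$. It is assumed that $P(A,b)\neq\emptyset$ and that $\mathrm{LP}(A,b,c)$ has an optimal solution (but $\mathrm{ILP}(A,b,c)$ may be infeasible). Let $\mathscr{H}(A,b)$ be the arrangement of the affine hyperplanes $\{x : a_{i,\cdot}x=b_i\}$ given by the rows of $(A|b)$; rows and hyperplanes are assumed to be in one-to-one correspondence. An automorphism of $\mathrm{LP}(A,b,c)$ is a linear transformation in $\mathrm{GL}_n\mathbb{R}$ which induces a permutation of $\mathscr{H}(A,b)$, leaves $P(A,b)$ invariant, and satisfies $c^t\gamma x=c^tx$ for all $x\in P(A,b)$. A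 symmetry of $\mathrm{ILP}(A,b,c)$ is an automorphism of $\mathrm{LP}(A,b,c)$ which acts on $\{\pm e_1,\dots,\pm e_n\}$ as a signed permutation; the symmetries form the group $\mathrm{Sym}(\mathrm{ILP}(A,b,c))$. A group acts $\mu$-transitively on a set if it acts on the set and is transitive on ordered $\mu$-tuples of distinct elements. Core Point Algorithm. Input: $(A,b)$. (1) Let $z=\zeta\mathbf{1}$, $\zeta\in\mathbb{R}$, be a symmetric optimal solution of $\mathrm{LP}(A,b,\mathbf{1})$. (2) Set $d\leftarrow\lfloor n\zeta\rfloor-n\lfloor\zeta\rfloor$. (3) Repeat: let $x$ be the vector whose first $d$ coordinates equal $\lfloor\zeta\rfloor+1$ and whose last $n-d$ coordinates equal $\lfloor\zeta\rfloor$; if $x\notin P(A,b)$, set $d\leftarrow d-1$; until a feasible $x$ is found or $d<0$. (4) Return the feasible $x$ found, or ``infeasible'' if none was found. Running time is measured in the RAM model: encoding lengths of real numbers are ignored and every arithmetic operation takes constant time. *)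

theory Defs
  imports
    "HOL-Algebra.Group_Action"
    "HOL-Library.State_Monad"
    "Jordan_Normal_Form.Matrix"
begin

section \<open>Linear and integer linear programs\<close>

definition ones_vec :: "nat \<Rightarrow> real vec" where
  "ones_vec n = vec n (\<lambda>_. 1)"

definition integer_vecs :: "nat \<Rightarrow> real vec set" where
  "integer_vecs n = {x \<in> carrier_vec n. \<forall>i<n. x $ i \<in> \<int>}"

definition polyhedron_of :: "real mat \<Rightarrow> real vec \<Rightarrow> real vec set" where
  "polyhedron_of A b = {x \<in> carrier_vec (dim_col A). A *\<^sub>v x \<le> b}"

definition maximizer :: "real vec \<Rightarrow> real vec set \<Rightarrow> real vec \<Rightarrow> bool" where
  "maximizer c X x \<longleftrightarrow> x \<in> X \<and> (\<forall>y\<in>X. c \<bullet> y \<le> c \<bullet> x)"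

definition lp_optimal :: "real mat \<Rightarrow> real vec \<Rightarrow> real vec \<Rightarrow> real vec \<Rightarrow> bool" where
  "lp_optimal A b c = maximizer c (polyhedron_of A b)"

definition ilp_feasible :: "real mat \<Rightarrow> real vec \<Rightarrow> real vec set" where
  "ilp_feasible A b = polyhedron_of A b \<inter> integer_vecs (dim_col A)"

definition ilp_optimal :: "real mat \<Rightarrow> real vec \<Rightarrow> real vec \<Rightarrow> real vec \<Rightarrow> bool" where
  "ilp_optimal A b c = maximizer c (ilp_feasible A b)"

definition hyperplane_of :: "real mat \<Rightarrow> real vec \<Rightarrow> nat \<Rightarrow> real vec set" where
  "hyperplane_of A b i = {x \<in> carrier_vec (dim_col A). row A i \<bullet> x = b $ i}"

definition arrangement :: "real mat \<Rightarrow> real vec \<Rightarrow> real vec set set" where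
  "arrangement A b = hyperplane_of A b ` {..<dim_row A}"

definition lp_instance :: "nat \<Rightarrow> nat \<Rightarrow> real mat \<Rightarrow> real vec \<Rightarrow> real vec \<Rightarrow> bool" where
  "lp_instance m n A b c \<longleftrightarrow>
     A \<in> carrier_mat m n \<and> b \<in> carrier_vec m \<and> c \<in> carrier_vec n \<and> c \<noteq> 0\<^sub>v n \<and>
     (\<forall>i<m. row A i \<noteq> 0\<^sub>v n) \<and>
     inj_on (hyperplane_of A b) {..<m} \<and>
     polyhedron_of A b \<noteq> {} \<and>
     (\<exists>x. lp_optimal A b c x)"


section \<open>Symmetries\<close>

definition GL :: "nat \<Rightarrow> real mat monoid" where
  "GL n = units_of (ring_mat TYPE(real) n ())"

definition standard_basis :: "nat \<Rightarrow> real vec set" where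
  "standard_basis n = unit_vec n ` {..<n}"

definition signed_standard_basis :: "nat \<Rightarrow> real vec set" where
  "signed_standard_basis n = standard_basis n \<union> uminus ` standard_basis n"

definition lp_automorphism ::
    "real mat \<Rightarrow> real vec \<Rightarrow> real vec \<Rightarrow> real mat \<Rightarrow> bool" where
  "lp_automorphism A b c \<gamma> \<longleftrightarrow>
     \<gamma> \<in> carrier (GL (dim_col A)) \<and>
     bij_betw (\<lambda>H. (\<lambda>x. \<gamma> *\<^sub>v x) ` H) (arrangement A b) (arrangement A b) \<and>
     (\<lambda>x. \<gamma> *\<^sub>v x) ` polyhedron_of A b = polyhedron_of A b \<and>
     (\<forall>x\<in>polyhedron_of A b. c \<bullet> (\<gamma> *\<^sub>v x) = c \<bullet> x)"

text \<open>A linear map that permutes the set of all \<open>e\<^sub>i\<close> and \<open>- e\<^sub>i\<close> commutes with negation,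
  hence it acts there as a signed permutation.\<close>

definition ilp_symmetry ::
    "real mat \<Rightarrow> real vec \<Rightarrow> real vec \<Rightarrow> real mat \<Rightarrow> bool" where
  "ilp_symmetry A b c \<gamma> \<longleftrightarrow>
     lp_automorphism A b c \<gamma> \<and>
     bij_betw (\<lambda>x. \<gamma> *\<^sub>v x)
       (signed_standard_basis (dim_col A)) (signed_standard_basis (dim_col A))"

definition Sym_ILP :: "real mat \<Rightarrow> real vec \<Rightarrow> real vec \<Rightarrow> real mat monoid" where
  "Sym_ILP A b c = (GL (dim_col A)) \<lparr>carrier := {\<gamma>. ilp_symmetry A b c \<gamma>}\<rparr>"

lemma GL_carrier_iff:
  "\<gamma> \<in> carrier (GL n) \<longleftrightarrow>
     \<gamma> \<in> carrier_mat n n \<and>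
     (\<exists>\<delta>\<in>carrier_mat n n. \<delta> * \<gamma> = 1\<^sub>m n \<and> \<gamma> * \<delta> = 1\<^sub>m n)"
  by (simp add: GL_def units_of_def Units_def ring_mat_simps)

lemma group_GL: "group (GL n)"
  unfolding GL_def
  by (intro monoid.units_group semiring.axioms(2)[OF semiring_mat])

lemma GL_mult [simp]: "monoid.mult (GL n) = (*)"
  and GL_one [simp]: "monoid.one (GL n) = 1\<^sub>m n"
  by (simp_all add: GL_def units_of_def ring_mat_simps)

lemma ilp_symmetry_one: "ilp_symmetry A b c (1\<^sub>m (dim_col A))"
proof -
  let ?n = "dim_col A"
  have id: "(\<lambda>x. 1\<^sub>m ?n *\<^sub>v x) ` X = X" if "X \<subseteq> carrier_vec ?n" for X :: "real vec set"
  proof -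
    have "(\<lambda>x. 1\<^sub>m ?n *\<^sub>v x) ` X = id ` X"
      using that by (intro image_cong) auto
    then show ?thesis by simp
  qed
  have H: "bij_betw (\<lambda>H. (\<lambda>x. 1\<^sub>m ?n *\<^sub>v x) ` H) (arrangement A b) (arrangement A b)"
  proof -
    have "bij_betw id (arrangement A b) (arrangement A b)" by simp
    moreover have "(\<lambda>x. 1\<^sub>m ?n *\<^sub>v x) ` X = id X" if "X \<in> arrangement A b" for X
      using that id[of X] by (auto simp: arrangement_def hyperplane_of_def)
    ultimately show ?thesis by (metis (no_types, lifting) bij_betw_cong)
  qed
  have S: "bij_betw (\<lambda>x. 1\<^sub>m ?n *\<^sub>v x)
      (signed_standard_basis ?n) (signed_standard_basis ?n)"
  proof -
    have "1\<^sub>m ?n *\<^sub>v x = id x" if "x \<in> signed_standard_basis ?n" for x :: "real vec"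
      using that by (auto simp: signed_standard_basis_def standard_basis_def)
    then show ?thesis by (metis (no_types, lifting) bij_betw_cong bij_betw_id)
  qed
  have "(1\<^sub>m ?n :: real mat) \<in> carrier (GL ?n)"
    by (auto simp: GL_carrier_iff intro!: bexI[of _ "1\<^sub>m ?n"])
  with H S show ?thesis
    by (auto simp: ilp_symmetry_def lp_automorphism_def id polyhedron_of_def)
qed

lemma ilp_symmetry_mult:
  assumes "ilp_symmetry A b c \<gamma>" "ilp_symmetry A b c \<delta>"
  shows "ilp_symmetry A b c (\<gamma> * \<delta>)"
proof -
  let ?n = "dim_col A" and ?P = "polyhedron_of A b"
  interpret group "GL ?n" by (rule group_GL)
  have g: "\<gamma> \<in> carrier (GL ?n)" and d: "\<delta> \<in> carrier (GL ?n)"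
    using assms by (auto simp: ilp_symmetry_def lp_automorphism_def)
  have gd: "\<gamma> * \<delta> \<in> carrier (GL ?n)" using m_closed[OF g d] by simp
  have g': "\<gamma> \<in> carrier_mat ?n ?n" and d': "\<delta> \<in> carrier_mat ?n ?n"
    using g d by (auto simp: GL_carrier_iff)
  have comp: "(\<gamma> * \<delta>) *\<^sub>v x = \<gamma> *\<^sub>v (\<delta> *\<^sub>v x)" if "x \<in> carrier_vec ?n" for x
    using assoc_mult_mat_vec[OF g' d' that] .
  have img: "(\<lambda>x. (\<gamma> * \<delta>) *\<^sub>v x) ` X = (\<lambda>x. \<gamma> *\<^sub>v x) ` ((\<lambda>x. \<delta> *\<^sub>v x) ` X)"
    if "X \<subseteq> carrier_vec ?n" for X
    unfolding image_image using that comp by (intro image_cong) auto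
  have P: "?P \<subseteq> carrier_vec ?n" by (auto simp: polyhedron_of_def)
  have "bij_betw ((\<lambda>H. (\<lambda>x. \<gamma> *\<^sub>v x) ` H) \<circ> (\<lambda>H. (\<lambda>x. \<delta> *\<^sub>v x) ` H))
      (arrangement A b) (arrangement A b)"
    using assms by (intro bij_betw_trans) (auto simp: ilp_symmetry_def lp_automorphism_def)
  moreover have "(\<lambda>x. (\<gamma> * \<delta>) *\<^sub>v x) ` X =
      ((\<lambda>H. (\<lambda>x. \<gamma> *\<^sub>v x) ` H) \<circ> (\<lambda>H. (\<lambda>x. \<delta> *\<^sub>v x) ` H)) X" if "X \<in> arrangement A b" for X
    using that img[of X] by (auto simp: arrangement_def hyperplane_of_def)
  ultimately have H: "bij_betw (\<lambda>H. (\<lambda>x. (\<gamma> * \<delta>) *\<^sub>v x) ` H) (arrangement A b) (arrangement A b)"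
    by (subst bij_betw_cong) auto
  have "bij_betw ((\<lambda>x. \<gamma> *\<^sub>v x) \<circ> (\<lambda>x. \<delta> *\<^sub>v x))
      (signed_standard_basis ?n) (signed_standard_basis ?n)"
    using assms by (intro bij_betw_trans) (auto simp: ilp_symmetry_def)
  moreover have "(\<gamma> * \<delta>) *\<^sub>v x = ((\<lambda>x. \<gamma> *\<^sub>v x) \<circ> (\<lambda>x. \<delta> *\<^sub>v x)) x"
    if "x \<in> signed_standard_basis ?n" for x
    using that comp[of x] by (auto simp: signed_standard_basis_def standard_basis_def)
  ultimately have S: "bij_betw (\<lambda>x. (\<gamma> * \<delta>) *\<^sub>v x)
      (signed_standard_basis ?n) (signed_standard_basis ?n)"
    by (subst bij_betw_cong) auto
  have gP: "(\<lambda>x. \<gamma> *\<^sub>v x) ` ?P = ?P" and dP: "(\<lambda>x. \<delta> *\<^sub>v x) ` ?P = ?P"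
    using assms by (auto simp: ilp_symmetry_def lp_automorphism_def)
  have P': "(\<lambda>x. (\<gamma> * \<delta>) *\<^sub>v x) ` ?P = ?P"
    using img[OF P] gP dP by simp
  have "c \<bullet> ((\<gamma> * \<delta>) *\<^sub>v x) = c \<bullet> x" if x: "x \<in> ?P" for x
  proof -
    have "\<delta> *\<^sub>v x \<in> ?P" using x dP by blast
    then have "c \<bullet> (\<gamma> *\<^sub>v (\<delta> *\<^sub>v x)) = c \<bullet> (\<delta> *\<^sub>v x)" "c \<bullet> (\<delta> *\<^sub>v x) = c \<bullet> x"
      using assms x by (auto simp: ilp_symmetry_def lp_automorphism_def)
    then show ?thesis using comp x P by auto
  qed
  with gd H S P' show ?thesis by (auto simp: ilp_symmetry_def lp_automorphism_def)
qed

lemma ilp_symmetry_inv: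
  assumes "ilp_symmetry A b c \<gamma>"
  shows "ilp_symmetry A b c (m_inv (GL (dim_col A)) \<gamma>)"
proof -
  let ?n = "dim_col A" and ?P = "polyhedron_of A b"
  define \<delta> where "\<delta> = m_inv (GL ?n) \<gamma>"
  interpret group "GL ?n" by (rule group_GL)
  have g: "\<gamma> \<in> carrier (GL ?n)"
    using assms by (auto simp: ilp_symmetry_def lp_automorphism_def)
  have d: "\<delta> \<in> carrier (GL ?n)" unfolding \<delta>_def using g by (rule inv_closed)
  have dg: "\<delta> * \<gamma> = 1\<^sub>m ?n" unfolding \<delta>_def using l_inv[OF g] by simp
  have g': "\<gamma> \<in> carrier_mat ?n ?n" and d': "\<delta> \<in> carrier_mat ?n ?n"
    using g d by (auto simp: GL_carrier_iff)
  have comp: "\<delta> *\<^sub>v (\<gamma> *\<^sub>v x) = x" if "x \<in> carrier_vec ?n" for x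
    using assoc_mult_mat_vec[OF d' g' that] dg that by simp
  have img: "(\<lambda>x. \<delta> *\<^sub>v x) ` ((\<lambda>x. \<gamma> *\<^sub>v x) ` X) = X" if "X \<subseteq> carrier_vec ?n" for X
  proof -
    have "(\<lambda>x. \<delta> *\<^sub>v x) ` ((\<lambda>x. \<gamma> *\<^sub>v x) ` X) = id ` X"
      unfolding image_image using that comp by (intro image_cong) auto
    then show ?thesis by simp
  qed
  have P: "?P \<subseteq> carrier_vec ?n" by (auto simp: polyhedron_of_def)
  have gP: "(\<lambda>x. \<gamma> *\<^sub>v x) ` ?P = ?P"
    using assms by (auto simp: ilp_symmetry_def lp_automorphism_def)
  have left_inverse: "bij_betw h S S" if "bij_betw f S S" "\<And>x. x \<in> S \<Longrightarrow> h (f x) = x" for f h S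
  proof -
    have "bij_betw (h \<circ> f) S S \<longleftrightarrow> bij_betw id S S"
      using that(2) by (intro bij_betw_cong) auto
    with that(1) show ?thesis by (simp add: bij_betw_comp_iff[symmetric])
  qed
  have "bij_betw (\<lambda>H. (\<lambda>x. \<gamma> *\<^sub>v x) ` H) (arrangement A b) (arrangement A b)"
    using assms by (auto simp: ilp_symmetry_def lp_automorphism_def)
  then have H: "bij_betw (\<lambda>H. (\<lambda>x. \<delta> *\<^sub>v x) ` H) (arrangement A b) (arrangement A b)"
    by (rule left_inverse) (rule img, auto simp: arrangement_def hyperplane_of_def)
  have "bij_betw (\<lambda>x. \<gamma> *\<^sub>v x) (signed_standard_basis ?n) (signed_standard_basis ?n)"
    using assms by (auto simp: ilp_symmetry_def)
  then have S: "bij_betw (\<lambda>x. \<delta> *\<^sub>v x) (signed_standard_basis ?n) (signed_standard_basis ?n)"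
    by (rule left_inverse) (rule comp, auto simp: signed_standard_basis_def standard_basis_def)
  have P': "(\<lambda>x. \<delta> *\<^sub>v x) ` ?P = ?P" using img[OF P] gP by simp
  have "c \<bullet> (\<delta> *\<^sub>v x) = c \<bullet> x" if x: "x \<in> ?P" for x
  proof -
    obtain y where y: "y \<in> ?P" "x = \<gamma> *\<^sub>v y" using x gP by blast
    then have "c \<bullet> (\<gamma> *\<^sub>v y) = c \<bullet> y"
      using assms by (auto simp: ilp_symmetry_def lp_automorphism_def)
    then show ?thesis using y comp P by auto
  qed
  with d H S P' show ?thesis
    unfolding \<delta>_def[symmetric] by (auto simp: ilp_symmetry_def lp_automorphism_def)
qed

lemma group_Sym_ILP: "group (Sym_ILP A b c)"
proof -
  interpret group "GL (dim_col A)" by (rule group_GL)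
  have "subgroup {\<gamma>. ilp_symmetry A b c \<gamma>} (GL (dim_col A))"
  proof (rule subgroupI)
    show "{\<gamma>. ilp_symmetry A b c \<gamma>} \<subseteq> carrier (GL (dim_col A))"
      by (auto simp: ilp_symmetry_def lp_automorphism_def)
    show "{\<gamma>. ilp_symmetry A b c \<gamma>} \<noteq> {}"
      using ilp_symmetry_one by blast
  qed (auto simp: ilp_symmetry_mult ilp_symmetry_inv)
  then show ?thesis
    unfolding Sym_ILP_def by (rule subgroup_imp_group)
qed

definition mu_transitive ::
    "('g, 'r) monoid_scheme \<Rightarrow> 'x set \<Rightarrow> ('g \<Rightarrow> 'x \<Rightarrow> 'x) \<Rightarrow> nat \<Rightarrow> bool" where
  "mu_transitive G S \<phi> \<mu> \<longleftrightarrow>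
     group_action G S \<phi> \<and>
     (\<forall>xs ys. length xs = \<mu> \<and> distinct xs \<and> set xs \<subseteq> S \<and>
              length ys = \<mu> \<and> distinct ys \<and> set ys \<subseteq> S
        \<longrightarrow> (\<exists>g\<in>carrier G. map (\<phi> g) xs = ys))"

definition basis_action :: "nat \<Rightarrow> real mat \<Rightarrow> real vec \<Rightarrow> real vec" where
  "basis_action n \<gamma> = restrict (\<lambda>x. \<gamma> *\<^sub>v x) (standard_basis n)"


section \<open>The Core Point Algorithm on a real RAM\<close>

text \<open>
  Programs run in a state monad whose state is the number of steps taken so far.
  The term \<open>step v\<close> is one RAM instruction with result \<open>v\<close>. In all programs below
  its argument is a single instruction on values already computed: reading an input entry,
  reading or writing an array cell, an arithmetic operation (including floor), a comparison or
  Boolean operation, or the assignment of a constant or a loop counter. Type coercions and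
  \<open>return\<close> cost nothing.
\<close>

type_synonym 'a timed = "(nat, 'a) state"

definition step :: "'a \<Rightarrow> 'a timed" where
  "step v = State (\<lambda>t. (v, Suc t))"

definition result_of :: "'a timed \<Rightarrow> 'a" where
  "result_of p = fst (run_state p 0)"

definition steps_of :: "'a timed \<Rightarrow> nat" where
  "steps_of p = snd (run_state p 0)"

text \<open>\<open>for_loop k body s\<close> executes \<open>body 0\<close>, ..., \<open>body (k - 1)\<close> in this
  order; every round and the final exit are charged one step for the loop control.\<close>

primrec for_loop :: "nat \<Rightarrow> (nat \<Rightarrow> 'a \<Rightarrow> 'a timed) \<Rightarrow> 'a \<Rightarrow> 'a timed" where
  "for_loop 0 body s = step s"
| "for_loop (Suc k) body s = do {
     s' \<leftarrow> for_loop k body s;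
     i \<leftarrow> step k;
     body i s'
   }"

text \<open>
  If the linear program is symmetric under a group that is transitive on the standard basis,
  the points fixed by the group form the line \<open>\<real>\<one>\<close>. On this line the \<open>i\<close>-th
  constraint reads \<open>\<zeta> s\<^sub>i \<le> b\<^sub>i\<close>, where \<open>s\<^sub>i\<close> is the \<open>i\<close>-th row sum of the matrix, and the
  largest feasible \<open>\<zeta>\<close> is the minimum of \<open>b\<^sub>i / s\<^sub>i\<close> over all \<open>i\<close> with \<open>s\<^sub>i > 0\<close>.
  The value \<open>None\<close> stands for ``no upper bound found''.
\<close>

definition row_sum :: "real mat \<Rightarrow> nat \<Rightarrow> real timed" where
  "row_sum A i = for_loop (dim_col A) (\<lambda>j s. do {
     a \<leftarrow> step (A $$ (i, j));
     step (s + a)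
   }) 0"

definition symmetric_lp_solution :: "real mat \<Rightarrow> real vec \<Rightarrow> real option timed" where
  "symmetric_lp_solution A b = for_loop (dim_row A) (\<lambda>i best. do {
     s \<leftarrow> row_sum A i;
     positive \<leftarrow> step (s > 0);
     if positive then do {
       \<beta> \<leftarrow> step (b $ i);
       r \<leftarrow> step (\<beta> / s);
       (case best of
          None \<Rightarrow> step (Some r)
        | Some \<zeta> \<Rightarrow> do {
            smaller \<leftarrow> step (r < \<zeta>);
            if smaller then step (Some r) else State_Monad.return best
          })
     } else State_Monad.return best
   }) None"

text \<open>An array of reals is a function from addresses to contents; the cells of a new array are
  overwritten before they are read.\<close>

definition candidate :: "nat \<Rightarrow> int \<Rightarrow> int \<Rightarrow> (nat \<Rightarrow> real) timed" where
  "candidate n q d = for_loop n (\<lambda>j x. do {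
     small \<leftarrow> step (int j < d);
     v \<leftarrow> (if small then step (real_of_int (q + 1)) else step (real_of_int q));
     step (x(j := v))
   }) (\<lambda>_. 0)"

definition row_product :: "real mat \<Rightarrow> nat \<Rightarrow> (nat \<Rightarrow> real) \<Rightarrow> real timed" where
  "row_product A i x = for_loop (dim_col A) (\<lambda>j s. do {
     a \<leftarrow> step (A $$ (i, j));
     v \<leftarrow> step (x j);
     p \<leftarrow> step (a * v);
     step (s + p)
   }) 0"

definition is_feasible :: "real mat \<Rightarrow> real vec \<Rightarrow> (nat \<Rightarrow> real) \<Rightarrow> bool timed" where
  "is_feasible A b x = for_loop (dim_row A) (\<lambda>i ok. do {
     s \<leftarrow> row_product A i x;
     \<beta> \<leftarrow> step (b $ i);
     sat \<leftarrow> step (s \<le> \<beta>);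
     step (ok \<and> sat)
   }) True"

text \<open>In the result of the algorithm, \<open>None\<close> stands for ``infeasible''; the term
  \<open>vec (dim_col A) x\<close> merely names the content of the array \<open>x\<close> that is handed over as output.
  The two instructions that decrement and test \<open>d\<close> are charged with \<open>step\<close>; the following
  lines repeat the terms \<open>d - 1\<close> and \<open>d - 1 < 0\<close> instead of naming their results, because the
  termination proof has to see the guard.\<close>

function core_point_search ::
    "real mat \<Rightarrow> real vec \<Rightarrow> int \<Rightarrow> int \<Rightarrow> real vec option timed" where
  "core_point_search A b q d = do {
     x \<leftarrow> candidate (dim_col A) q d;
     feasible \<leftarrow> is_feasible A b x;
     if feasible then State_Monad.return (Some (vec (dim_col A) x))
     else do {
       _ \<leftarrow> step (d - 1);
       _ \<leftarrow> step (d - 1 < 0);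
       if d - 1 < 0 then State_Monad.return None else core_point_search A b q (d - 1)
     }
   }"
  by pat_completeness auto
termination
  by (relation "measure (\<lambda>(A, b, q, d). nat d)") auto

declare core_point_search.simps [simp del]

definition core_point_algorithm :: "real mat \<Rightarrow> real vec \<Rightarrow> real vec option timed" where
  "core_point_algorithm A b = do {
     optimum \<leftarrow> symmetric_lp_solution A b;
     (case optimum of
        None \<Rightarrow> State_Monad.return None \<comment> \<open>cannot happen if the linear program is bounded\<close>
      | Some \<zeta> \<Rightarrow> do {
          n \<leftarrow> step (dim_col A);
          r \<leftarrow> step (real n * \<zeta>);
          f \<leftarrow> step \<lfloor>r\<rfloor>;
          q \<leftarrow> step \<lfloor>\<zeta>\<rfloor>;
          p \<leftarrow> step (int n * q);
          d \<leftarrow> step (f - p);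
          core_point_search A b q d
        })
   }"

end

theory Submission
  imports Defs
begin

text \<open>Coordinate permutations that preserve the polyhedron act transitively on the subsets
  of each size \<open>d\<close>, and the stabilizer of such a subset is transitive on the subset and on its
  complement. Averaging a feasible integer point with coordinate sum \<open>n q + d\<close>, where
  \<open>0 \<le> d < n\<close>, over the symmetries that carry the first \<open>d\<close> indices to the positions of its
  \<open>d\<close> largest coordinates gives a feasible point with a constant value \<open>\<alpha>\<close> on the first \<open>d\<close>
  coordinates and a constant value on the others. Integrality forces \<open>\<alpha> \<ge> q + 1\<close>, so the
  candidate of the algorithm lies on the segment from this average to the mean, and the
  candidate is feasible whenever some integer point with the same coordinate sum is. If a
  feasible integer point has coordinate sum below \<open>n \<lfloor>\<zeta>\<rfloor>\<close>, then \<open>\<lfloor>\<zeta>\<rfloor> \<one>\<close>, the candidate for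
  \<open>d = 0\<close>, lies between two feasible multiples of \<open>\<one>\<close> and is feasible as well.\<close>

section \<open>Partial correctness with step bounds\<close>

text \<open>The bound is required from every initial counter value \<open>t\<close>, so that costs
  add up under \<open>bind\<close>, where the second program starts at the final counter of the
  first.\<close>

definition achieves :: "'a timed \<Rightarrow> nat \<Rightarrow> ('a \<Rightarrow> bool) \<Rightarrow> bool" where
  "achieves p c Q \<longleftrightarrow> (\<forall>t. Q (fst (run_state p t)) \<and> snd (run_state p t) \<le> t + c)"

lemma achieves_result: "achieves p c Q \<Longrightarrow> Q (result_of p)"
  by (simp add: achieves_def result_of_def)

lemma achieves_steps: "achieves p c Q \<Longrightarrow> steps_of p \<le> c"
  by (metis achieves_def add_0 steps_of_def)

lemma achieves_weaken:
  assumes "achieves p c Q" "c \<le> c'" "\<And>v. Q v \<Longrightarrow> R v"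
  shows "achieves p c' R"
  using assms unfolding achieves_def by (meson add_left_mono order_trans)

lemma achieves_return: "Q v \<Longrightarrow> achieves (State_Monad.return v) c Q"
  by (simp add: achieves_def State_Monad.return_def)

lemma achieves_step: "Q v \<Longrightarrow> 1 \<le> c \<Longrightarrow> achieves (step v) c Q"
  by (simp add: achieves_def step_def)

lemma achieves_bind:
  assumes "achieves p c Q" "\<And>v. Q v \<Longrightarrow> achieves (f v) c' R"
  shows "achieves (State_Monad.bind p f) (c + c') R"
  unfolding achieves_def
proof
  fix t
  obtain v t' where run: "run_state p t = (v, t')" by fastforce
  with assms(1) have "Q v" "t' \<le> t + c" by (auto simp: achieves_def dest: spec[of _ t])
  with assms(2)[of v] have "R (fst (run_state (f v) t'))" "snd (run_state (f v) t') \<le> t' + c'"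
    by (auto simp: achieves_def)
  with run \<open>t' \<le> t + c\<close> show "R (fst (run_state (State_Monad.bind p f) t)) \<and>
      snd (run_state (State_Monad.bind p f) t) \<le> t + (c + c')"
    by simp
qed

lemma achieves_bind_step:
  assumes "achieves (f v) c R"
  shows "achieves (State_Monad.bind (step v) f) (Suc c) R"
  using achieves_bind[of "step v" 1 "\<lambda>w. w = v" f c R] assms by (simp add: achieves_step)

text \<open>\<open>I i\<close> is the invariant before round \<open>i\<close>. The factor
  \<open>Suc c\<close> pays for the body and the loop control of a round, the final 1 for leaving
  the loop.\<close>

lemma achieves_for_loop:
  assumes "I 0 s" "\<And>i s. i < k \<Longrightarrow> I i s \<Longrightarrow> achieves (body i s) c (I (Suc i))"
  shows "achieves (for_loop k body s) (k * Suc c + 1) (I k)"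
  using assms(2)
proof (induction k)
  case 0
  then show ?case by (simp add: achieves_step assms(1))
next
  case (Suc k)
  have "achieves (for_loop (Suc k) body s) ((k * Suc c + 1) + Suc c) (I (Suc k))"
    unfolding for_loop.simps
    by (rule achieves_bind[OF Suc.IH]) (auto intro!: achieves_bind_step Suc.prems)
  then show ?case by (rule achieves_weaken) auto
qed


section \<open>Solutions of the linear system\<close>

text \<open>Points are functions on all of \<open>nat\<close> whose values from
  \<open>dim_col A\<close> on are ignored. A coordinate permutation then acts by composition, and
  averages are pointwise.\<close>

definition solution_set :: "real mat \<Rightarrow> real vec \<Rightarrow> (nat \<Rightarrow> real) set" where
  "solution_set A b = {x. \<forall>i<dim_row A. (\<Sum>j<dim_col A. A $$ (i, j) * x j) \<le> b $ i}"

lemma polyhedron_of_iff: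
  assumes "dim_vec b = dim_row A"
  shows "x \<in> polyhedron_of A b \<longleftrightarrow> x \<in> carrier_vec (dim_col A) \<and> ($) x \<in> solution_set A b"
proof -
  have "(A *\<^sub>v x) $ i = (\<Sum>j<dim_col A. A $$ (i, j) * x $ j)"
    if "x \<in> carrier_vec (dim_col A)" "i < dim_row A" for i
    using that by (auto simp: scalar_prod_def lessThan_atLeast0 intro!: sum.cong)
  with assms show ?thesis
    by (auto simp: polyhedron_of_def solution_set_def less_eq_vec_def)
qed

lemma solution_set_cong:
  assumes "\<And>j. j < dim_col A \<Longrightarrow> x j = y j"
  shows "x \<in> solution_set A b \<longleftrightarrow> y \<in> solution_set A b"
  using assms by (simp add: solution_set_def)

lemma vec_in_polyhedron_of_iff:
  assumes "dim_vec b = dim_row A"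
  shows "vec (dim_col A) x \<in> polyhedron_of A b \<longleftrightarrow> x \<in> solution_set A b"
  using solution_set_cong[of A "($) (vec (dim_col A) x)" x b]
  by (simp add: polyhedron_of_iff[OF assms])

lemma ones_vec_scalar_prod:
  assumes "x \<in> carrier_vec n"
  shows "ones_vec n \<bullet> x = (\<Sum>j<n. x $ j)"
  using assms by (auto simp: ones_vec_def scalar_prod_def lessThan_atLeast0 intro!: sum.cong)

lemma solution_set_average:
  assumes "finite H" "H \<noteq> {}" "\<And>h. h \<in> H \<Longrightarrow> f h \<in> solution_set A b"
  shows "(\<lambda>j. (\<Sum>h\<in>H. f h j) / card H) \<in> solution_set A b"
  unfolding solution_set_def
proof (intro CollectI allI impI)
  fix i assume i: "i < dim_row A"
  have pos: "card H > 0" using assms by (simp add: card_gt_0_iff)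
  have "(\<Sum>j<dim_col A. A $$ (i, j) * ((\<Sum>h\<in>H. f h j) / card H))
      = (\<Sum>h\<in>H. \<Sum>j<dim_col A. A $$ (i, j) * f h j) / card H"
    by (subst sum.swap) (simp add: sum_distrib_left sum_divide_distrib)
  also have "\<dots> \<le> (\<Sum>h\<in>H. b $ i) / card H"
    using assms(3) i by (intro divide_right_mono sum_mono) (auto simp: solution_set_def)
  also have "\<dots> = b $ i" using pos by simp
  finally show "(\<Sum>j<dim_col A. A $$ (i, j) * ((\<Sum>h\<in>H. f h j) / card H)) \<le> b $ i" .
qed

lemma solution_set_segment:
  assumes "x \<in> solution_set A b" "y \<in> solution_set A b" "0 \<le> t" "t \<le> 1"
  shows "(\<lambda>j. (1 - t) * x j + t * y j) \<in> solution_set A b"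
  unfolding solution_set_def
proof (intro CollectI allI impI)
  fix i assume i: "i < dim_row A"
  have "(\<Sum>j<dim_col A. A $$ (i, j) * ((1 - t) * x j + t * y j))
      = (1 - t) * (\<Sum>j<dim_col A. A $$ (i, j) * x j) + t * (\<Sum>j<dim_col A. A $$ (i, j) * y j)"
    by (simp add: sum_distrib_left sum.distrib[symmetric] algebra_simps)
  also have "\<dots> \<le> b $ i"
    using assms i by (intro convex_bound_le) (auto simp: solution_set_def)
  finally show "(\<Sum>j<dim_col A. A $$ (i, j) * ((1 - t) * x j + t * y j)) \<le> b $ i" .
qed

lemma constant_solution_between:
  assumes "(\<lambda>_. r) \<in> solution_set A b" "(\<lambda>_. t) \<in> solution_set A b" "r \<le> s" "s \<le> t"
  shows "(\<lambda>_. s) \<in> solution_set A b"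
proof (cases "r = t")
  case False
  with assms have "r < t" by simp
  define u where "u = (s - r) / (t - r)"
  have "0 \<le> u" "u \<le> 1" using assms \<open>r < t\<close> by (auto simp: u_def)
  moreover have "(1 - u) * r + u * t = s"
  proof -
    have "u * (t - r) = s - r" using \<open>r < t\<close> by (simp add: u_def)
    then show ?thesis by (simp add: algebra_simps)
  qed
  ultimately show ?thesis using solution_set_segment[OF assms(1,2), of u] by simp
qed (use assms in simp)

section \<open>Coordinate permutations and step points\<close>

definition coordinate_symmetries :: "real mat \<Rightarrow> real vec \<Rightarrow> (nat \<Rightarrow> nat) set" where
  "coordinate_symmetries A b =
     {\<sigma>. \<sigma> permutes {..<dim_col A} \<and> (\<forall>x\<in>solution_set A b. x \<circ> \<sigma> \<in> solution_set A b)}"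

lemma coordinate_symmetries_comp:
  assumes "\<sigma> \<in> coordinate_symmetries A b" "\<tau> \<in> coordinate_symmetries A b"
  shows "\<sigma> \<circ> \<tau> \<in> coordinate_symmetries A b"
  using assms by (auto simp: coordinate_symmetries_def permutes_compose comp_assoc[symmetric])

text \<open>For \<open>d < n\<close> this is, up to the order of the coordinates, the integer point
  with coordinate sum \<open>n * q + d\<close> nearest to the diagonal.\<close>

definition step_point :: "int \<Rightarrow> nat \<Rightarrow> nat \<Rightarrow> real" where
  "step_point q d j = (if j < d then of_int (q + 1) else of_int q)"

lemma sum_step_point:
  assumes "d \<le> n"
  shows "(\<Sum>j<n. step_point q d j) = of_int (int n * q + int d)"
proof -
  have "(\<Sum>j<n. step_point q d j) = (\<Sum>j<n. of_int q + (if j < d then 1 else 0))"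
    by (intro sum.cong) (auto simp: step_point_def)
  also have "\<dots> = real n * of_int q + (\<Sum>j<n. if j < d then 1 else 0)"
    by (simp add: sum.distrib)
  also have "(\<Sum>j<n. if j < d then 1 else 0) = real (card ({..<n} \<inter> {j. j < d}))"
    by (simp add: sum.If_cases)
  also have "{..<n} \<inter> {j. j < d} = {..<d}" using assms by auto
  finally show ?thesis by simp
qed

text \<open>Greedy choice: an index of maximal value outside \<open>T\<close> dominates the
  remaining ones and is dominated by those in \<open>T\<close>, so it can be added to
  \<open>T\<close>.\<close>

lemma largest_coordinates:
  fixes y :: "nat \<Rightarrow> int"
  assumes "finite N" "d \<le> card N"
  shows "\<exists>T\<subseteq>N. card T = d \<and> (\<forall>i\<in>T. \<forall>j\<in>N - T. y j \<le> y i)"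
  using assms(2)
proof (induction d)
  case 0
  show ?case by (rule exI[of _ "{}"]) auto
next
  case (Suc d)
  then obtain T where T: "T \<subseteq> N" "card T = d" "\<forall>i\<in>T. \<forall>j\<in>N - T. y j \<le> y i" by auto
  have "finite T" using T assms finite_subset by blast
  have "N - T \<noteq> {}" using T Suc.prems \<open>finite T\<close> card_mono[of T N] by auto
  then have "Max (y ` (N - T)) \<in> y ` (N - T)" using assms(1) by (intro Max_in) auto
  then obtain k where k: "k \<in> N - T" "Max (y ` (N - T)) = y k" by blast
  with assms(1) have "\<forall>j\<in>N - T. y j \<le> y k" by (metis Max_ge finite_Diff finite_imageI imageI)
  show ?case
    by (rule exI[of _ "insert k T"]) (use T k \<open>finite T\<close> \<open>\<forall>j\<in>N - T. y j \<le> y k\<close> in auto)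
qed

section \<open>Transitivity on index lists and index sets, and the averages it yields\<close>

locale highly_transitive =
  fixes A :: "real mat" and b :: "real vec"
  assumes transitive:
    "\<lbrakk>length xs = dim_col A div 2 + 1; distinct xs; set xs \<subseteq> {..<dim_col A};
      length ys = dim_col A div 2 + 1; distinct ys; set ys \<subseteq> {..<dim_col A}\<rbrakk>
     \<Longrightarrow> \<exists>\<sigma>\<in>coordinate_symmetries A b. map \<sigma> xs = ys"
    and dim_pos: "dim_col A > 0"
begin

abbreviation n where "n \<equiv> dim_col A"
abbreviation G where "G \<equiv> coordinate_symmetries A b"

lemma permutes_G: "\<sigma> \<in> G \<Longrightarrow> \<sigma> permutes {..<n}"
  by (simp add: coordinate_symmetries_def)

lemma finite_G: "finite G"
  by (rule finite_subset[OF _ finite_permutations[of "{..<n}"]]) (auto dest: permutes_G)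

lemma extend_list:
  assumes "distinct xs" "set xs \<subseteq> {..<n}" "length xs \<le> l" "l \<le> n"
  shows "\<exists>zs. length (xs @ zs) = l \<and> distinct (xs @ zs) \<and> set (xs @ zs) \<subseteq> {..<n}"
proof -
  have "card ({..<n} - set xs) = n - length xs"
    using assms by (simp add: card_Diff_subset distinct_card)
  then obtain Z where Z: "Z \<subseteq> {..<n} - set xs" "card Z = l - length xs"
    by (metis obtain_subset_with_card_n assms(4) diff_le_mono)
  moreover have "finite Z" using Z finite_subset by blast
  ultimately obtain zs where "set zs = Z" "distinct zs" using finite_distinct_list by blast
  with Z assms show ?thesis
    by (intro exI[of _ zs]) (auto simp: distinct_card[symmetric])
qed

text \<open>Both lists are padded to length \<open>n div 2 + 1\<close>, and the images of the
  padding are forgotten.\<close>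

lemma transitive_short:
  assumes "length xs = length ys" "length xs \<le> n div 2 + 1"
    "distinct xs" "set xs \<subseteq> {..<n}" "distinct ys" "set ys \<subseteq> {..<n}"
  shows "\<exists>\<sigma>\<in>G. map \<sigma> xs = ys"
proof -
  have l: "n div 2 + 1 \<le> n" using dim_pos by simp
  obtain us where us: "length (xs @ us) = n div 2 + 1" "distinct (xs @ us)" "set (xs @ us) \<subseteq> {..<n}"
    using extend_list[of xs "n div 2 + 1"] assms l by auto
  obtain vs where vs: "length (ys @ vs) = n div 2 + 1" "distinct (ys @ vs)" "set (ys @ vs) \<subseteq> {..<n}"
    using extend_list[of ys "n div 2 + 1"] assms l by auto
  obtain \<sigma> where "\<sigma> \<in> G" "map \<sigma> (xs @ us) = ys @ vs" using transitive[OF us vs] by blast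
  with assms(1) show ?thesis by (intro bexI[of _ \<sigma>]) auto
qed

text \<open>The index \<open>i\<close> followed by the elements of \<open>S - {i}\<close> forms a
  list of at most \<open>card S + 1\<close> entries; this is where the extra 1 in the degree of
  transitivity enters. The last assumption makes the lists for \<open>S\<close> and \<open>T\<close>
  equally long.\<close>

lemma transitive_sets_small:
  assumes "S \<subseteq> {..<n}" "T \<subseteq> {..<n}" "card S = card T" "card S \<le> n div 2"
    "i < n" "j < n" "i \<in> S \<longleftrightarrow> j \<in> T"
  shows "\<exists>\<sigma>\<in>G. \<sigma> ` S = T \<and> \<sigma> i = j"
proof -
  have fin: "finite S" "finite T" using assms finite_subset by blast+
  obtain xs where xs: "set xs = S - {i}" "distinct xs"
    using finite_distinct_list[of "S - {i}"] fin by auto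
  obtain ys where ys: "set ys = T - {j}" "distinct ys"
    using finite_distinct_list[of "T - {j}"] fin by auto
  have "length xs = card (S - {i})" "length ys = card (T - {j})"
    using xs ys distinct_card by metis+
  then have len: "length xs = length ys" "length xs \<le> card S"
    using assms fin by (auto simp: card_Diff_singleton_if)
  then obtain \<sigma> where \<sigma>: "\<sigma> \<in> G" "map \<sigma> (i # xs) = j # ys"
    using transitive_short[of "i # xs" "j # ys"] xs ys assms by auto
  then have "\<sigma> i = j" by simp
  moreover have "\<sigma> ` (S - {i}) = T - {j}" using \<sigma> xs ys by (metis list.set_map list.simps(9) list.inject)
  ultimately have "\<sigma> ` S = T" using assms(7)
    by (cases "i \<in> S") (metis image_insert insert_Diff, simp)
  with \<sigma> \<open>\<sigma> i = j\<close> show ?thesis by blast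
qed

text \<open>A set with more than half of the indices is handled through its complement, which
  has fewer than \<open>n div 2 + 1\<close> elements.\<close>

lemma transitive_sets:
  assumes "S \<subseteq> {..<n}" "T \<subseteq> {..<n}" "card S = card T"
    "i < n" "j < n" "i \<in> S \<longleftrightarrow> j \<in> T"
  shows "\<exists>\<sigma>\<in>G. \<sigma> ` S = T \<and> \<sigma> i = j"
proof (cases "card S \<le> n div 2")
  case True
  with assms show ?thesis by (intro transitive_sets_small)
next
  case False
  have fin: "finite S" "finite T" using assms finite_subset by blast+
  have "card ({..<n} - S) = n - card S" "card ({..<n} - T) = n - card T"
    using fin assms by (simp_all add: card_Diff_subset)
  then obtain \<sigma> where \<sigma>: "\<sigma> \<in> G" "\<sigma> ` ({..<n} - S) = {..<n} - T" "\<sigma> i = j"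
    using transitive_sets_small[of "{..<n} - S" "{..<n} - T" i j] assms False
      diff_le_mono2[of "n div 2 + 1" "card S" n] by fastforce
  have "\<sigma> ` S = \<sigma> ` ({..<n} - ({..<n} - S))" using assms by (simp add: double_diff)
  also have "\<dots> = \<sigma> ` {..<n} - \<sigma> ` ({..<n} - S)"
    using permutes_inj[OF permutes_G[OF \<sigma>(1)]] by (simp add: image_set_diff)
  also have "\<dots> = T" using \<sigma> permutes_image[OF permutes_G[OF \<sigma>(1)]] assms by auto
  finally show ?thesis using \<sigma> by blast
qed

text \<open>Averages over the symmetries that carry the first \<open>d\<close> indices to \<open>T\<close>. When \<open>d = 0\<close>
  or \<open>d = n\<close>, the branch that divides by \<open>0\<close> concerns no coordinate below \<open>n\<close>.\<close>

lemma block_average: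
  assumes T: "T \<subseteq> {..<n}" and x: "x \<in> solution_set A b"
  shows "(\<lambda>i. if i < card T then sum x T / card T else sum x ({..<n} - T) / (n - card T))
    \<in> solution_set A b"
proof -
  define d where "d = card T"
  define H where "H = {\<sigma>\<in>G. \<sigma> ` {..<d} = T}"
  define z where "z i = (\<Sum>\<sigma>\<in>H. x (\<sigma> i)) / card H" for i
  have dn: "d \<le> n" using card_mono[OF _ T] by (simp add: d_def)
  have finT: "finite T" using T finite_subset by blast
  have "finite H" using finite_G by (simp add: H_def)
  have "H \<noteq> {}"
  proof -
    \<comment> \<open>\<open>transitive_sets\<close> also moves a prescribed index, so index 0 needs
      a target that lies in \<open>T\<close> exactly if 0 lies in the first block.\<close>
    obtain j where "j < n" "0 < d \<longleftrightarrow> j \<in> T"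
    proof (cases "d = 0")
      case True
      with finT dim_pos show ?thesis by (intro that[of 0]) (auto simp: d_def)
    next
      case False
      then obtain j where "j \<in> T" unfolding d_def by fastforce
      with T False show ?thesis by (intro that[of j]) auto
    qed
    then show ?thesis
      using transitive_sets[of "{..<d}" T 0 j] T dn dim_pos by (auto simp: H_def d_def)
  qed
  have z: "z \<in> solution_set A b"
    unfolding z_def
    using solution_set_average[OF \<open>finite H\<close> \<open>H \<noteq> {}\<close>, of "\<lambda>\<sigma>. x \<circ> \<sigma>" A b] x
    by (auto simp: H_def coordinate_symmetries_def)
  \<comment> \<open>A symmetry \<open>\<tau>\<close> that stabilizes the first block permutes
    \<open>H\<close> by composition from the right. Reindexing the sum by this permutation equates
    the averages at \<open>i\<close> and at \<open>j = \<tau> i\<close>.\<close>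
  have z_const: "z i = z j" if ij: "i < n" "j < n" "i < d \<longleftrightarrow> j < d" for i j
  proof -
    obtain \<tau> where \<tau>: "\<tau> \<in> G" "\<tau> ` {..<d} = {..<d}" "\<tau> i = j"
      using transitive_sets[of "{..<d}" "{..<d}" i j] ij dn
      unfolding lessThan_iff lessThan_subset_iff by blast
    have "bij \<tau>" using \<tau> permutes_G permutes_bij by blast
    have inj: "inj_on (\<lambda>\<sigma>. \<sigma> \<circ> \<tau>) H"
      by (rule inj_onI) (metis \<open>bij \<tau>\<close> bij_is_surj comp_assoc comp_id surj_iff)
    have into: "(\<lambda>\<sigma>. \<sigma> \<circ> \<tau>) ` H \<subseteq> H"
    proof (rule image_subsetI)
      fix \<sigma> assume "\<sigma> \<in> H"
      then have "\<sigma> \<in> G" "\<sigma> ` {..<d} = T" by (simp_all add: H_def)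
      then have "\<sigma> \<circ> \<tau> \<in> G" "(\<sigma> \<circ> \<tau>) ` {..<d} = T"
        using coordinate_symmetries_comp[OF _ \<tau>(1)] image_comp[of \<sigma> \<tau> "{..<d}"] \<tau>(2) by simp_all
      then show "\<sigma> \<circ> \<tau> \<in> H" unfolding H_def by simp
    qed
    have "bij_betw (\<lambda>\<sigma>. \<sigma> \<circ> \<tau>) H H"
      using endo_inj_surj[OF \<open>finite H\<close> into inj] inj by (simp add: bij_betw_def)
    then have "(\<Sum>\<sigma>\<in>H. x ((\<sigma> \<circ> \<tau>) i)) = (\<Sum>\<sigma>\<in>H. x (\<sigma> i))"
      by (rule sum.reindex_bij_betw[where g = "\<lambda>\<sigma>. x (\<sigma> i)"])
    with \<tau> show ?thesis by (simp add: z_def)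
  qed
  \<comment> \<open>If all of \<open>H\<close> maps \<open>S\<close> onto the same set
    \<open>U\<close>, every permuted point has the sum of \<open>x\<close> over \<open>U\<close> on
    \<open>S\<close>, and so has their average. Together with \<open>z_const\<close> this determines
    \<open>z\<close> on each block.\<close>
  have z_sum: "sum z S = sum x U" if "\<And>\<sigma>. \<sigma> \<in> H \<Longrightarrow> \<sigma> ` S = U" for S U
  proof -
    have "(\<Sum>i\<in>S. x (\<sigma> i)) = sum x U" if "\<sigma> \<in> H" for \<sigma>
    proof -
      have "inj \<sigma>" using that permutes_G permutes_inj by (auto simp: H_def)
      then have "sum x (\<sigma> ` S) = (\<Sum>i\<in>S. x (\<sigma> i))"
        by (subst sum.reindex) (auto intro: inj_on_subset)
      then show ?thesis using \<open>\<And>\<sigma>. \<sigma> \<in> H \<Longrightarrow> \<sigma> ` S = U\<close> that by simp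
    qed
    then have "(\<Sum>i\<in>S. \<Sum>\<sigma>\<in>H. x (\<sigma> i)) = card H * sum x U"
      by (subst sum.swap) simp
    then show ?thesis using \<open>finite H\<close> \<open>H \<noteq> {}\<close> by (simp add: z_def sum_divide_distrib[symmetric])
  qed
  have "z i = (if i < d then sum x T / d else sum x ({..<n} - T) / (n - d))" if i: "i < n" for i
  proof (cases "i < d")
    case True
    have "sum z {..<d} = (\<Sum>j<d. z i)" using True dn by (intro sum.cong z_const) auto
    moreover have "sum z {..<d} = sum x T" by (rule z_sum) (simp add: H_def)
    ultimately show ?thesis using True by (simp add: field_simps)
  next
    case False
    have "sum z {d..<n} = (\<Sum>j\<in>{d..<n}. z i)" using False i by (intro sum.cong z_const) auto
    moreover have "sum z {d..<n} = sum x ({..<n} - T)"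
    proof (rule z_sum)
      fix \<sigma> assume \<sigma>: "\<sigma> \<in> H"
      then have p: "\<sigma> permutes {..<n}" using permutes_G by (simp add: H_def)
      have "{d..<n} = {..<n} - {..<d}" by auto
      then have "\<sigma> ` {d..<n} = \<sigma> ` {..<n} - \<sigma> ` {..<d}"
        by (simp only: image_set_diff[OF permutes_inj[OF p]])
      then show "\<sigma> ` {d..<n} = {..<n} - T"
        using \<sigma> permutes_image[OF p] by (simp add: H_def)
    qed
    ultimately show ?thesis using False i by (simp add: field_simps)
  qed
  then show ?thesis unfolding d_def by (rule iffD1[OF solution_set_cong z])
qed

text \<open>This is the block average with all indices in one block; its second branch is never
  reached below \<open>n\<close>.\<close>

lemma mean_solution:
  assumes "x \<in> solution_set A b"
  shows "(\<lambda>_. (\<Sum>j<n. x j) / n) \<in> solution_set A b"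
  using block_average[of "{..<n}" x] assms
  by (subst solution_set_cong) auto

text \<open>The block average of \<open>y\<close> over its \<open>d\<close> largest coordinates, the step point and the
  mean of \<open>y\<close> are collinear, and integrality of \<open>y\<close> puts the step point between the other two.\<close>

lemma step_point_solution:
  fixes y :: "nat \<Rightarrow> int"
  assumes y: "(\<lambda>j. of_int (y j)) \<in> solution_set A b"
    and sum_y: "(\<Sum>j<n. y j) = int n * q + int d" and d: "d < n"
  shows "step_point q d \<in> solution_set A b"
proof -
  define r where "r = real_of_int (\<Sum>j<n. y j) / n"
  have r: "r = q + d / n" using sum_y dim_pos by (simp add: r_def field_simps)
  have mean: "(\<lambda>_. r) \<in> solution_set A b" using mean_solution[OF y] by (simp add: r_def)
  show ?thesis
  proof (cases "d = 0")
    \<comment> \<open>This case is separate because \<open>\<alpha>\<close> below divides by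
      \<open>d\<close>. Here the step point is the mean itself.\<close>
    case True
    have "step_point q d = (\<lambda>_. r)" by (simp add: r True step_point_def fun_eq_iff)
    then show ?thesis using mean by simp
  next
    case False
    obtain T where T: "T \<subseteq> {..<n}" "card T = d" "\<forall>i\<in>T. \<forall>j\<in>{..<n} - T. y j \<le> y i"
      using largest_coordinates[of "{..<n}" d y] d by auto
    have finT: "finite T" using T finite_subset by blast
    have split: "sum y T + sum y ({..<n} - T) = int n * q + int d"
      using sum.subset_diff[OF T(1), of y] sum_y by simp
    \<comment> \<open>If some coordinate in \<open>T\<close> is at most \<open>q\<close>, then so is
      every coordinate outside \<open>T\<close>. These contribute at most \<open>(n - d) * q\<close>
      to the total \<open>n * q + d\<close>, which leaves at least \<open>d * (q + 1)\<close> for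
      \<open>T\<close>.\<close>
    have top: "sum y T \<ge> int d * (q + 1)"
    proof (cases "\<forall>i\<in>T. q + 1 \<le> y i")
      case True
      then have "(\<Sum>i\<in>T. q + 1) \<le> sum y T" by (intro sum_mono) auto
      then show ?thesis using T by simp
    next
      case False
      then obtain i where i: "i \<in> T" "y i \<le> q" by force
      then have "sum y ({..<n} - T) \<le> (\<Sum>j\<in>{..<n} - T. q)"
        using T by (intro sum_mono) force
      also have "\<dots> = int (n - d) * q" using T finT by (simp add: card_Diff_subset)
      finally show ?thesis using split d by (simp add: algebra_simps of_nat_diff)
    qed
    define \<alpha> where "\<alpha> = real_of_int (sum y T) / d"
    define \<beta> where "\<beta> = real_of_int (sum y ({..<n} - T)) / (n - d)"
    have block: "(\<lambda>i. if i < d then \<alpha> else \<beta>) \<in> solution_set A b"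
      using block_average[OF T(1) y] unfolding \<alpha>_def \<beta>_def of_int_sum T(2) .
    have "real_of_int (sum y T) \<ge> of_int (int d * (q + 1))" using top by (simp only: of_int_le_iff)
    then have \<alpha>: "\<alpha> \<ge> q + 1" using False by (simp add: \<alpha>_def field_simps)
    have "r < q + 1" using d by (simp add: r)
    \<comment> \<open>The parameter at which the segment from the mean to the block average takes
      the value \<open>q + 1\<close> on the first block. It is at most 1 because
      \<open>\<alpha> \<ge> q + 1 > r\<close>.\<close>
    define t where "t = (q + 1 - r) / (\<alpha> - r)"
    have t: "t * (\<alpha> - r) = q + 1 - r" "0 \<le> t" "t \<le> 1"
      using \<alpha> \<open>r < q + 1\<close> by (auto simp: t_def)
    have "d * \<alpha> + (n - d) * \<beta> = real_of_int (sum y T + sum y ({..<n} - T))"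
      using d False by (simp add: \<alpha>_def \<beta>_def)
    moreover have nr: "real n * r = n * q + d" using dim_pos by (simp add: r field_simps)
    \<comment> \<open>The block average has mean \<open>r\<close>, so its deviations from
      \<open>r\<close> on the two blocks cancel. The same holds for the step point, so agreement at
      \<open>t\<close> on the first block forces agreement on the second.\<close>
    ultimately have balance: "(n - d) * (\<beta> - r) = - (d * (\<alpha> - r))"
      using split d by (simp add: algebra_simps of_nat_diff)
    have "(n - d) * (t * (\<beta> - r)) = t * ((n - d) * (\<beta> - r))" by simp
    also have "\<dots> = - (d * (t * (\<alpha> - r)))" by (simp add: balance)
    also have "\<dots> = (n - d) * (q - r)"
      unfolding t(1) using nr d by (simp add: algebra_simps of_nat_diff)
    finally have \<beta>: "t * (\<beta> - r) = q - r" using d by simp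
    have "step_point q d = (\<lambda>i. (1 - t) * r + t * (if i < d then \<alpha> else \<beta>))"
      using t(1) \<beta> by (auto simp: step_point_def algebra_simps)
    then show ?thesis using solution_set_segment[OF mean block t(2,3)] by simp
  qed
qed

end


section \<open>From matrix symmetries to coordinate symmetries\<close>

text \<open>Acting on the standard basis itself rules out negative signs, so \<open>\<gamma>\<close>
  is a permutation matrix. The inverse appears because entry \<open>k\<close> of the image comes
  from the position that \<open>\<pi>\<close> sends to \<open>k\<close>.\<close>

lemma symmetry_permutation:
  assumes "group_action (Sym_ILP A b c) (standard_basis (dim_col A)) (basis_action (dim_col A))"
    and g: "\<gamma> \<in> carrier (Sym_ILP A b c)"
  shows "\<exists>\<pi>. \<pi> permutes {..<dim_col A} \<and>
    (\<forall>i<dim_col A. \<gamma> *\<^sub>v unit_vec (dim_col A) i = unit_vec (dim_col A) (\<pi> i)) \<and>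
    (\<forall>x\<in>carrier_vec (dim_col A). \<gamma> *\<^sub>v x = vec (dim_col A) (($) x \<circ> inv_into UNIV \<pi>))"
proof -
  define n where "n = dim_col A"
  have \<gamma>: "\<gamma> \<in> carrier_mat n n"
    using g by (auto simp: Sym_ILP_def ilp_symmetry_def lp_automorphism_def GL_carrier_iff n_def)
  have "basis_action n \<gamma> ` standard_basis n = standard_basis n" "inj_on (basis_action n \<gamma>) (standard_basis n)"
    using group_action.surj_prop[OF assms] group_action.inj_prop[OF assms] by (simp_all add: n_def)
  then have img: "(*\<^sub>v) \<gamma> ` standard_basis n = standard_basis n" and inj: "inj_on ((*\<^sub>v) \<gamma>) (standard_basis n)"
    by (simp_all add: basis_action_def inj_on_restrict_eq)
  have "\<exists>j<n. \<gamma> *\<^sub>v unit_vec n i = unit_vec n j" if "i < n" for i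
    using img that by (force simp: standard_basis_def)
  then obtain p where p: "\<And>i. i < n \<Longrightarrow> p i < n" "\<And>i. i < n \<Longrightarrow> \<gamma> *\<^sub>v unit_vec n i = unit_vec n (p i)"
    by metis
  \<comment> \<open>The identity beyond \<open>n\<close> is what \<open>permutes\<close>
    demands.\<close>
  define \<pi> where "\<pi> i = (if i < n then p i else i)" for i
  have unit: "\<gamma> *\<^sub>v unit_vec n i = unit_vec n (\<pi> i)" if "i < n" for i
    using p that by (simp add: \<pi>_def)
  have "inj_on \<pi> {..<n}"
  proof (rule inj_onI)
    fix i j assume ij: "i \<in> {..<n}" "j \<in> {..<n}" "\<pi> i = \<pi> j"
    then have "\<gamma> *\<^sub>v unit_vec n i = \<gamma> *\<^sub>v unit_vec n j" by (simp add: unit)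
    moreover have "unit_vec n i \<in> standard_basis n" "unit_vec n j \<in> standard_basis n"
      unfolding standard_basis_def using ij by blast+
    ultimately have "unit_vec n i = (unit_vec n j :: real vec)" by (rule inj_onD[OF inj])
    then show "i = j" using ij by simp
  qed
  moreover have "\<pi> ` {..<n} \<subseteq> {..<n}" using p by (auto simp: \<pi>_def)
  ultimately have "bij_betw \<pi> {..<n} {..<n}" by (simp add: bij_betw_def endo_inj_surj)
  then have perm: "\<pi> permutes {..<n}" by (rule bij_imp_permutes) (simp add: \<pi>_def)
  have entry: "\<gamma> $$ (k, i) = (if k = \<pi> i then 1 else 0)" if "i < n" "k < n" for i k
  proof -
    have "\<gamma> $$ (k, i) = (\<gamma> *\<^sub>v unit_vec n i) $ k" using \<gamma> that by simp
    also have "\<dots> = (if k = \<pi> i then 1 else 0)"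
      using that by (simp add: unit) (simp add: unit_vec_def)
    finally show ?thesis .
  qed
  have "\<gamma> *\<^sub>v x = vec n (($) x \<circ> inv_into UNIV \<pi>)" if x: "x \<in> carrier_vec n" for x
  proof (rule eq_vecI)
    fix k assume "k < dim_vec (vec n (($) x \<circ> inv_into UNIV \<pi>))"
    then have k: "k < n" by simp
    have ik: "inv_into UNIV \<pi> k < n" using permutes_in_image[OF permutes_inv[OF perm], of k] k by simp
    have "(\<gamma> *\<^sub>v x) $ k = (\<Sum>i<n. \<gamma> $$ (k, i) * x $ i)"
      using \<gamma> x k by (auto simp: scalar_prod_def lessThan_atLeast0 intro!: sum.cong)
    also have "\<dots> = (\<Sum>i<n. if i = inv_into UNIV \<pi> k then x $ i else 0)"
      using k permutes_inverses[OF perm] by (intro sum.cong) (auto simp: entry)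
    also have "\<dots> = x $ inv_into UNIV \<pi> k" using ik by simp
    finally show "(\<gamma> *\<^sub>v x) $ k = vec n (($) x \<circ> inv_into UNIV \<pi>) $ k" using k by simp
  qed (use \<gamma> in auto)
  with perm unit show ?thesis unfolding n_def by blast
qed

text \<open>A matrix symmetry induces a permutation of the indices of the basis vectors, and the
  inverse of that permutation is a coordinate symmetry.\<close>

lemma highly_transitive_Sym_ILP:
  assumes inst: "lp_instance m n A b (ones_vec n)"
    and trans: "mu_transitive (Sym_ILP A b (ones_vec n)) (standard_basis n) (basis_action n) (n div 2 + 1)"
  shows "highly_transitive A b"
proof
  have n: "dim_col A = n" and dim: "dim_vec b = dim_row A"
    using inst by (auto simp: lp_instance_def)
  \<comment> \<open>In dimension 0 the objective would be the zero vector, which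
    \<open>lp_instance\<close> excludes.\<close>
  show "dim_col A > 0"
  proof (rule ccontr)
    assume "\<not> dim_col A > 0"
    then have "ones_vec n = 0\<^sub>v n" using n by (auto simp: ones_vec_def)
    then show False using inst by (simp add: lp_instance_def)
  qed
  have act: "group_action (Sym_ILP A b (ones_vec n)) (standard_basis (dim_col A)) (basis_action (dim_col A))"
    using trans by (simp add: mu_transitive_def n)
  fix xs ys :: "nat list"
  assume xs: "length xs = dim_col A div 2 + 1" "distinct xs" "set xs \<subseteq> {..<dim_col A}"
    and ys: "length ys = dim_col A div 2 + 1" "distinct ys" "set ys \<subseteq> {..<dim_col A}"
  let ?e = "unit_vec n :: nat \<Rightarrow> real vec"
  have e: "distinct (map ?e zs)" "set (map ?e zs) \<subseteq> standard_basis n"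
    if "distinct zs" "set zs \<subseteq> {..<dim_col A}" for zs
    using that by (auto simp: distinct_map n inj_on_def standard_basis_def)
  \<comment> \<open>The lists are exchanged: \<open>\<gamma>\<close> has to send \<open>ys\<close>
    to \<open>xs\<close>, since it is the inverse permutation that becomes the coordinate
    symmetry.\<close>
  obtain \<gamma> where \<gamma>: "\<gamma> \<in> carrier (Sym_ILP A b (ones_vec n))"
      "map (basis_action n \<gamma>) (map ?e ys) = map ?e xs"
    using trans xs ys e[of xs] e[of ys] unfolding mu_transitive_def
    by (metis length_map n)
  obtain \<pi> where \<pi>: "\<pi> permutes {..<n}" "\<And>i. i < n \<Longrightarrow> \<gamma> *\<^sub>v ?e i = ?e (\<pi> i)"
      "\<And>x. x \<in> carrier_vec n \<Longrightarrow> \<gamma> *\<^sub>v x = vec n (($) x \<circ> inv_into UNIV \<pi>)"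
    using symmetry_permutation[OF act \<gamma>(1)] n by auto
  have "x \<circ> inv_into UNIV \<pi> \<in> solution_set A b" if x: "x \<in> solution_set A b" for x
  proof -
    have "vec n x \<in> polyhedron_of A b" using x n vec_in_polyhedron_of_iff[OF dim] by simp
    then have "\<gamma> *\<^sub>v vec n x \<in> polyhedron_of A b"
      using \<gamma>(1) by (auto simp: Sym_ILP_def ilp_symmetry_def lp_automorphism_def)
    moreover have "\<gamma> *\<^sub>v vec n x = vec n (x \<circ> inv_into UNIV \<pi>)"
    proof -
      have "inv_into UNIV \<pi> k < n" if "k < n" for k
        using permutes_in_image[OF permutes_inv[OF \<pi>(1)], of k] that by simp
      moreover have "\<gamma> *\<^sub>v vec n x = vec n (($) (vec n x) \<circ> inv_into UNIV \<pi>)" by (rule \<pi>(3)) simp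
      ultimately show ?thesis by (intro eq_vecI) simp_all
    qed
    ultimately show ?thesis using n vec_in_polyhedron_of_iff[OF dim] by simp
  qed
  then have mem: "inv_into UNIV \<pi> \<in> coordinate_symmetries A b"
    using permutes_inv[OF \<pi>(1)] by (simp add: coordinate_symmetries_def n)
  have "map \<pi> ys = xs"
  proof (rule nth_equalityI)
    fix k assume k: "k < length (map \<pi> ys)"
    then have len: "k < length xs" "k < length ys" using xs(1) ys(1) by simp_all
    then have "ys ! k \<in> {..<n}" "xs ! k \<in> {..<n}"
      using subsetD[OF xs(3)] subsetD[OF ys(3)] unfolding n by simp_all
    then have "ys ! k < n" "xs ! k < n" by simp_all
    have "basis_action n \<gamma> (?e (ys ! k)) = ?e (xs ! k)"
      using arg_cong[OF \<gamma>(2), of "\<lambda>l. l ! k"] len by simp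
    then have "?e (\<pi> (ys ! k)) = ?e (xs ! k)"
      using \<pi>(2)[OF \<open>ys ! k < n\<close>] \<open>ys ! k < n\<close> by (simp add: basis_action_def standard_basis_def)
    moreover have "\<pi> (ys ! k) < n" using permutes_in_image[OF \<pi>(1)] \<open>ys ! k < n\<close> by simp
    ultimately show "map \<pi> ys ! k = xs ! k" using k \<open>xs ! k < n\<close> by simp
  qed (use xs ys in simp)
  then have "map (inv_into UNIV \<pi>) xs = ys" using permutes_inverses[OF \<pi>(1)] by (auto simp: o_def)
  with mem show "\<exists>\<sigma>\<in>coordinate_symmetries A b. map \<sigma> xs = ys" by blast
qed


section \<open>The algorithm\<close>

lemma row_sum_achieves:
  "achieves (row_sum A i) (3 * dim_col A + 1) (\<lambda>s. s = (\<Sum>j<dim_col A. A $$ (i, j)))"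
  unfolding row_sum_def
  by (rule achieves_weaken[OF achieves_for_loop[where c = 2 and I = "\<lambda>k s. s = (\<Sum>j<k. A $$ (i, j))"]])
    (auto simp: numeral_2_eq_2 intro!: achieves_bind_step achieves_step)

lemma symmetric_lp_solution_achieves:
  "achieves (symmetric_lp_solution A b) (dim_row A * (3 * dim_col A + 7) + 1)
    (\<lambda>r. case r of
        None \<Rightarrow> \<forall>i<dim_row A. (\<Sum>j<dim_col A. A $$ (i, j)) \<le> 0
      | Some \<zeta> \<Rightarrow>
          (\<exists>i<dim_row A. (\<Sum>j<dim_col A. A $$ (i, j)) > 0 \<and> \<zeta> = b $ i / (\<Sum>j<dim_col A. A $$ (i, j))) \<and>
          (\<forall>i<dim_row A. (\<Sum>j<dim_col A. A $$ (i, j)) > 0 \<longrightarrow> \<zeta> \<le> b $ i / (\<Sum>j<dim_col A. A $$ (i, j))))"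
proof -
  define s where "s i = (\<Sum>j<dim_col A. A $$ (i, j))" for i
  define I where "I k r = (case r of
        None \<Rightarrow> \<forall>i<k. s i \<le> 0
      | Some \<zeta> \<Rightarrow> (\<exists>i<k. s i > 0 \<and> \<zeta> = b $ i / s i) \<and> (\<forall>i<k. s i > 0 \<longrightarrow> \<zeta> \<le> b $ i / s i))" for k r
  \<comment> \<open>The three possible rounds: the row gives no upper bound, its ratio does not
    improve on the minimum so far, or its ratio becomes the new minimum.\<close>
  have keep: "I (Suc i) r" if "I i r" "s i \<le> 0" for i r
    using that by (force simp: I_def less_Suc_eq split: option.splits)
  have keep_smaller: "I (Suc i) (Some \<zeta>)" if "I i (Some \<zeta>)" "\<zeta> \<le> b $ i / s i" for i \<zeta>
    using that by (force simp: I_def less_Suc_eq)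
  have replace: "I (Suc i) (Some (b $ i / s i))"
    if "I i r" "s i > 0" "\<And>\<zeta>. r = Some \<zeta> \<Longrightarrow> b $ i / s i < \<zeta>" for i r
    using that by (force simp: I_def less_Suc_eq split: option.splits)
  have "achieves (symmetric_lp_solution A b) (dim_row A * Suc (3 * dim_col A + 6) + 1) (I (dim_row A))"
    unfolding symmetric_lp_solution_def
  proof (rule achieves_for_loop)
    show "I 0 None" by (simp add: I_def)
    fix i best assume "I i best"
    \<comment> \<open>Beyond the row sum, a round takes at most five steps: sign test, reading,
      division, comparison and storing.\<close>
    then show "achieves (State_Monad.bind (row_sum A i) (\<lambda>s. State_Monad.bind (step (s > 0)) (\<lambda>positive.
        if positive then State_Monad.bind (step (b $ i)) (\<lambda>\<beta>. State_Monad.bind (step (\<beta> / s)) (\<lambda>r.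
          case best of None \<Rightarrow> step (Some r)
          | Some \<zeta> \<Rightarrow> State_Monad.bind (step (r < \<zeta>)) (\<lambda>smaller.
              if smaller then step (Some r) else State_Monad.return best)))
        else State_Monad.return best))) (3 * dim_col A + 6) (I (Suc i))"
      by (intro achieves_weaken[OF achieves_bind[OF row_sum_achieves, where c' = 5]],
        auto simp: s_def[symmetric] eval_nat_numeral not_less split: option.split
          intro!: achieves_bind_step achieves_step achieves_return)
        (auto intro: keep keep_smaller replace)
  qed
  then show ?thesis unfolding I_def s_def by (rule achieves_weaken) simp_all
qed

lemma candidate_achieves:
  "achieves (candidate n q (int d)) (4 * n + 1) (\<lambda>x. \<forall>j<n. x j = step_point q d j)"
  unfolding candidate_def
  by (rule achieves_weaken[OF achieves_for_loop[where c = 3 and I = "\<lambda>k x. \<forall>j<k. x j = step_point q d j"]])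
    (auto simp: eval_nat_numeral step_point_def less_Suc_eq intro!: achieves_bind_step achieves_step)

lemma row_product_achieves:
  "achieves (row_product A i x) (5 * dim_col A + 1) (\<lambda>s. s = (\<Sum>j<dim_col A. A $$ (i, j) * x j))"
  unfolding row_product_def
  by (rule achieves_weaken[OF achieves_for_loop[where c = 4 and I = "\<lambda>k s. s = (\<Sum>j<k. A $$ (i, j) * x j)"]])
    (auto simp: eval_nat_numeral intro!: achieves_bind_step achieves_step)

lemma is_feasible_achieves:
  "achieves (is_feasible A b x) (dim_row A * (5 * dim_col A + 5) + 1) (\<lambda>ok. ok \<longleftrightarrow> x \<in> solution_set A b)"
  unfolding is_feasible_def
proof (rule achieves_weaken[OF achieves_for_loop[where c = "5 * dim_col A + 4" and
      I = "\<lambda>k ok. ok \<longleftrightarrow> (\<forall>i<k. (\<Sum>j<dim_col A. A $$ (i, j) * x j) \<le> b $ i)"]])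
  show "achieves (State_Monad.bind (row_product A i x) (\<lambda>s. State_Monad.bind (step (b $ i)) (\<lambda>\<beta>.
      State_Monad.bind (step (s \<le> \<beta>)) (\<lambda>sat. step (ok \<and> sat))))) (5 * dim_col A + 4)
      (\<lambda>ok. ok \<longleftrightarrow> (\<forall>l<Suc i. (\<Sum>j<dim_col A. A $$ (l, j) * x j) \<le> b $ l))"
    if "ok \<longleftrightarrow> (\<forall>l<i. (\<Sum>j<dim_col A. A $$ (l, j) * x j) \<le> b $ l)" for i ok
    using that
    by (intro achieves_weaken[OF achieves_bind[OF row_product_achieves, where c' = 3]])
      (auto simp: eval_nat_numeral less_Suc_eq intro!: achieves_bind_step achieves_step)
qed (auto simp: solution_set_def)

text \<open>The search counts down from \<open>d\<close>, so its first success is at the largest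
  feasible \<open>k\<close>, after at most \<open>Suc d\<close> candidates.\<close>

lemma core_point_search_achieves:
  "achieves (core_point_search A b q (int d))
     (Suc d * (4 * dim_col A + dim_row A * (5 * dim_col A + 5) + 4))
     (\<lambda>r. case r of
        None \<Rightarrow> \<forall>k\<le>d. step_point q k \<notin> solution_set A b
      | Some x \<Rightarrow> \<exists>k\<le>d. x = vec (dim_col A) (step_point q k) \<and> step_point q k \<in> solution_set A b \<and>
          (\<forall>l\<le>d. k < l \<longrightarrow> step_point q l \<notin> solution_set A b))"
  (is "achieves _ _ (?Q d)")
proof (induction d)
  let ?n = "dim_col A"
  \<comment> \<open>The cost of one round: \<open>4 * ?n + 1\<close> for the candidate,
    \<open>dim_row A * (5 * ?n + 5) + 1\<close> for the feasibility test, and 2 for decrementing and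
    testing \<open>d\<close>.\<close>
  define K where "K = 4 * ?n + dim_row A * (5 * ?n + 5) + 4"
  \<comment> \<open>One unfolding of the recursion, with the cost of everything after a failed test
    collected in \<open>c\<close>. It is used with \<open>c = 0\<close> at the end of the countdown
    and with the induction hypothesis otherwise.\<close>
  have round: "achieves (core_point_search A b q (int d)) (K + c) (?Q d)"
    if rest: "step_point q d \<notin> solution_set A b \<Longrightarrow>
      achieves (if int d - 1 < 0 then State_Monad.return None else core_point_search A b q (int d - 1)) c (?Q d)"
    for d c
    unfolding core_point_search.simps[of A b q "int d"]
  proof (rule achieves_weaken[OF achieves_bind[OF candidate_achieves achieves_bind[OF is_feasible_achieves]]])
    fix x ok
    assume x: "\<forall>j<?n. x j = step_point q d j" and "ok \<longleftrightarrow> x \<in> solution_set A b"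
    then have ok: "ok \<longleftrightarrow> step_point q d \<in> solution_set A b"
      using solution_set_cong[of A x "step_point q d" b] by simp
    have "vec ?n x = vec ?n (step_point q d)" using x by auto
    then show "achieves (if ok then State_Monad.return (Some (vec ?n x))
        else State_Monad.bind (step (int d - 1)) (\<lambda>_. State_Monad.bind (step (int d - 1 < 0)) (\<lambda>_.
          if int d - 1 < 0 then State_Monad.return None else core_point_search A b q (int d - 1))))
        (Suc (Suc c)) (?Q d)"
      using ok rest by (auto intro!: achieves_return achieves_bind_step exI[of _ d])
  qed (simp_all add: K_def)
  {
    case 0
    have "achieves (core_point_search A b q (int 0)) (K + 0) (?Q 0)"
      by (rule round) (simp add: achieves_return)
    then show ?case by (rule achieves_weaken) (simp_all add: K_def)
  next
    case (Suc d)
    have "achieves (core_point_search A b q (int (Suc d))) (K + Suc d * K) (?Q (Suc d))"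
    proof (rule round)
      assume no: "step_point q (Suc d) \<notin> solution_set A b"
      have "achieves (core_point_search A b q (int d)) (Suc d * K) (?Q (Suc d))"
        using Suc.IH unfolding K_def[symmetric]
        by (rule achieves_weaken) (use no in \<open>auto simp: le_Suc_eq split: option.splits\<close>)
      then show "achieves (if int (Suc d) - 1 < 0 then State_Monad.return None
          else core_point_search A b q (int (Suc d) - 1)) (Suc d * K) (?Q (Suc d))"
        by simp
    qed
    then show ?case by (simp add: K_def[symmetric])
  }
qed

section \<open>Optimality of the computed points\<close>

context highly_transitive
begin

text \<open>The maximum over the line of constant points is the maximum over all solutions, since
  passing to the mean preserves solutions and the objective value.\<close>

lemma symmetric_lp_solution_optimal:
  assumes ne: "solution_set A b \<noteq> {}" and bound: "\<And>x. x \<in> solution_set A b \<Longrightarrow> (\<Sum>j<n. x j) \<le> v"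
  shows "achieves (symmetric_lp_solution A b) (dim_row A * (3 * n + 7) + 1)
    (\<lambda>r. \<exists>\<zeta>. r = Some \<zeta> \<and> (\<lambda>_. \<zeta>) \<in> solution_set A b \<and>
      (\<forall>x\<in>solution_set A b. (\<Sum>j<n. x j) \<le> real n * \<zeta>))"
proof (rule achieves_weaken[OF symmetric_lp_solution_achieves order_refl])
  define s where "s i = (\<Sum>j<n. A $$ (i, j))" for i
  have const: "(\<lambda>_. t) \<in> solution_set A b \<longleftrightarrow> (\<forall>i<dim_row A. s i * t \<le> b $ i)" for t
    by (simp add: solution_set_def s_def sum_distrib_right)
  obtain t where t: "(\<lambda>_. t) \<in> solution_set A b" using ne mean_solution by blast
  fix r
  assume r: "case r of
        None \<Rightarrow> \<forall>i<dim_row A. (\<Sum>j<n. A $$ (i, j)) \<le> 0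
      | Some \<zeta> \<Rightarrow>
          (\<exists>i<dim_row A. (\<Sum>j<n. A $$ (i, j)) > 0 \<and> \<zeta> = b $ i / (\<Sum>j<n. A $$ (i, j))) \<and>
          (\<forall>i<dim_row A. (\<Sum>j<n. A $$ (i, j)) > 0 \<longrightarrow> \<zeta> \<le> b $ i / (\<Sum>j<n. A $$ (i, j)))"
  show "\<exists>\<zeta>. r = Some \<zeta> \<and> (\<lambda>_. \<zeta>) \<in> solution_set A b \<and>
      (\<forall>x\<in>solution_set A b. (\<Sum>j<n. x j) \<le> real n * \<zeta>)"
  proof (cases r)
    case None
    \<comment> \<open>Without a positive row sum, every constant above a feasible one is feasible.
      The constant \<open>u\<close> exceeds \<open>v / n\<close>, which contradicts the bound on the
      objective.\<close>
    define u where "u = max t (v / n + 1)"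
    have "s i * u \<le> b $ i" if "i < dim_row A" for i
    proof -
      have "s i * u \<le> s i * t" using r None that by (intro mult_left_mono_neg) (auto simp: s_def u_def)
      then show ?thesis using t that const by force
    qed
    then have "n * u \<le> v" using bound[of "\<lambda>_. u"] const by simp
    moreover have "u > v / n" by (simp add: u_def)
    ultimately show ?thesis using dim_pos by (simp add: field_simps)
  next
    case (Some \<zeta>)
    then obtain k where k: "k < dim_row A" "s k > 0" "\<zeta> = b $ k / s k"
      and le: "\<And>i. i < dim_row A \<Longrightarrow> s i > 0 \<Longrightarrow> \<zeta> \<le> b $ i / s i"
      using r by (auto simp: s_def)
    \<comment> \<open>Row \<open>k\<close> has a positive sum and attains the minimal ratio, so its
      constraint caps every feasible constant at \<open>\<zeta>\<close>.\<close>
    have upper: "t' \<le> \<zeta>" if "(\<lambda>_. t') \<in> solution_set A b" for t'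
      using that k by (auto simp: const pos_le_divide_eq mult.commute)
    have "s i * \<zeta> \<le> b $ i" if i: "i < dim_row A" for i
    proof (cases "s i > 0")
      case True
      then show ?thesis using le[OF i] by (simp add: field_simps)
    next
      case False
      \<comment> \<open>A row with nonpositive sum does not become tighter as the constant grows
        from the feasible \<open>t\<close> to \<open>\<zeta>\<close>.\<close>
      then have "s i * \<zeta> \<le> s i * t" using upper[OF t] by (intro mult_left_mono_neg) auto
      then show ?thesis using t i const by force
    qed
    moreover have "(\<Sum>j<n. x j) \<le> real n * \<zeta>" if "x \<in> solution_set A b" for x
      using upper[OF mean_solution[OF that]] dim_pos by (simp add: field_simps)
    ultimately show ?thesis using Some const by auto
  qed
qed

text \<open>Each integer solution is dominated in the objective by a feasible step point within the
  range of the search. Hence the first success is optimal, and failure means infeasibility. In the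
  bound, 6 pays for the instructions before the search and the factor \<open>n\<close> for its
  rounds.\<close>

lemma core_point_algorithm_achieves:
  assumes "solution_set A b \<noteq> {}" "\<And>x. x \<in> solution_set A b \<Longrightarrow> (\<Sum>j<n. x j) \<le> v"
  shows "achieves (core_point_algorithm A b)
    (dim_row A * (3 * n + 7) + 1 + (6 + n * (4 * n + dim_row A * (5 * n + 5) + 4)))
    (\<lambda>r. case r of
        None \<Rightarrow> \<forall>y::nat \<Rightarrow> int. (\<lambda>j. of_int (y j)) \<notin> solution_set A b
      | Some x \<Rightarrow> \<exists>z::nat \<Rightarrow> int. x = vec n (\<lambda>j. of_int (z j)) \<and>
          (\<lambda>j. of_int (z j)) \<in> solution_set A b \<and>
          (\<forall>y::nat \<Rightarrow> int. (\<lambda>j. of_int (y j)) \<in> solution_set A b \<longrightarrow> (\<Sum>j<n. y j) \<le> (\<Sum>j<n. z j)))"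
    (is "achieves _ _ ?R")
  unfolding core_point_algorithm_def
proof (rule achieves_bind[OF symmetric_lp_solution_optimal[OF assms]], assumption, elim exE conjE)
  fix r \<zeta>
  assume r: "r = Some \<zeta>" and const: "(\<lambda>_. \<zeta>) \<in> solution_set A b"
    and opt: "\<forall>x\<in>solution_set A b. (\<Sum>j<n. x j) \<le> real n * \<zeta>"
  define q where "q = \<lfloor>\<zeta>\<rfloor>"
  define d where "d = nat (\<lfloor>real n * \<zeta>\<rfloor> - int n * q)"
  have q: "of_int q \<le> \<zeta>" "\<zeta> < of_int q + 1" by (simp_all add: q_def)
  \<comment> \<open>Rounding \<open>\<zeta>\<close> down to \<open>q\<close> yields
    \<open>0 \<le> d < n\<close>: the conversion to \<open>nat\<close> loses nothing, and there are
    at most \<open>n\<close> rounds.\<close>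
  have "of_int (int n * q) \<le> real n * \<zeta>" using q by (simp add: mult_left_mono)
  then have d: "int d = \<lfloor>real n * \<zeta>\<rfloor> - int n * q" by (simp add: d_def le_floor_iff)
  have "real n * \<zeta> < real n * (of_int q + 1)" using q dim_pos by (intro mult_strict_left_mono) auto
  then have "real n * \<zeta> < of_int (int n * q + int n)" by (simp add: algebra_simps)
  then have "\<lfloor>real n * \<zeta>\<rfloor> < int n * q + int n" by (simp only: floor_less_iff)
  then have dn: "d < n" using d by linarith
  have zero: "step_point q 0 = (\<lambda>_. of_int q)" by (simp add: step_point_def fun_eq_iff)
  have dominated: "\<exists>k\<le>d. step_point q k \<in> solution_set A b \<and> (\<Sum>j<n. y j) \<le> int n * q + int k"
    if y: "(\<lambda>j. of_int (y j)) \<in> solution_set A b" for y :: "nat \<Rightarrow> int"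
  proof (cases "(\<Sum>j<n. y j) < int n * q")
    case True
    have "real_of_int (\<Sum>j<n. y j) \<le> of_int (int n * q)" using True by (simp only: of_int_le_iff)
    then have "real_of_int (\<Sum>j<n. y j) / n \<le> of_int q" using dim_pos by (simp add: field_simps)
    then have "(\<lambda>_. of_int q) \<in> solution_set A b"
      using constant_solution_between[OF _ const _ q(1)] mean_solution[OF y] by simp
    with True show ?thesis using zero by (intro exI[of _ 0]) auto
  next
    case False
    define k where "k = nat ((\<Sum>j<n. y j) - int n * q)"
    have k: "(\<Sum>j<n. y j) = int n * q + int k" using False by (simp add: k_def)
    have "real_of_int (\<Sum>j<n. y j) \<le> real n * \<zeta>" using opt y by simp
    then have "(\<Sum>j<n. y j) \<le> \<lfloor>real n * \<zeta>\<rfloor>" by (simp only: le_floor_iff)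
    then have "k \<le> d" using k d by linarith
    then show ?thesis using step_point_solution[OF y k] dn k by auto
  qed
  have "achieves (core_point_search A b q (int d)) (Suc d * (4 * n + dim_row A * (5 * n + 5) + 4)) ?R"
  proof (rule achieves_weaken[OF core_point_search_achieves order_refl])
    fix s
    assume s: "case s of
        None \<Rightarrow> \<forall>k\<le>d. step_point q k \<notin> solution_set A b
      | Some x \<Rightarrow> \<exists>k\<le>d. x = vec n (step_point q k) \<and> step_point q k \<in> solution_set A b \<and>
          (\<forall>l\<le>d. k < l \<longrightarrow> step_point q l \<notin> solution_set A b)"
    show "?R s"
    proof (cases s)
      case None
      then show ?thesis using s dominated by fastforce
    next
      case (Some x)
      then obtain k where k: "k \<le> d" "x = vec n (step_point q k)" "step_point q k \<in> solution_set A b"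
        "\<And>l. l \<le> d \<Longrightarrow> k < l \<Longrightarrow> step_point q l \<notin> solution_set A b"
        using s by auto
      \<comment> \<open>The integer-valued copy of the step point.\<close>
      define z where "z j = (if j < k then q + 1 else q)" for j
      have z: "(\<lambda>j. of_int (z j)) = step_point q k" by (auto simp: z_def step_point_def)
      have "real_of_int (\<Sum>j<n. z j) = of_int (int n * q + int k)"
        using sum_step_point[of k n q] k(1) dn by (simp add: z[symmetric])
      then have sum_z: "(\<Sum>j<n. z j) = int n * q + int k" by (simp only: of_int_eq_iff)
      have "(\<Sum>j<n. y j) \<le> (\<Sum>j<n. z j)" if y: "(\<lambda>j. of_int (y j)) \<in> solution_set A b" for y :: "nat \<Rightarrow> int"
      proof -
        obtain l where l: "l \<le> d" "step_point q l \<in> solution_set A b" "(\<Sum>j<n. y j) \<le> int n * q + int l"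
          using dominated[OF y] by blast
        then have "l \<le> k" using k(4)[OF l(1)] by (meson not_less)
        with l(3) sum_z show ?thesis by linarith
      qed
      then show ?thesis using Some k z by (auto intro!: exI[of _ z])
    qed
  qed
  then have "achieves (core_point_search A b q (int d)) (n * (4 * n + dim_row A * (5 * n + 5) + 4)) ?R"
    by (rule achieves_weaken) (use dn in \<open>auto intro!: mult_right_mono simp del: mult_Suc\<close>)
  then show "achieves (case r of None \<Rightarrow> State_Monad.return None
      | Some \<zeta> \<Rightarrow> State_Monad.bind (step n) (\<lambda>n. State_Monad.bind (step (real n * \<zeta>)) (\<lambda>r.
          State_Monad.bind (step \<lfloor>r\<rfloor>) (\<lambda>f. State_Monad.bind (step \<lfloor>\<zeta>\<rfloor>) (\<lambda>q.
          State_Monad.bind (step (int n * q)) (\<lambda>p. State_Monad.bind (step (f - p)) (\<lambda>d.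
          core_point_search A b q d)))))))
      (6 + n * (4 * n + dim_row A * (5 * n + 5) + 4)) ?R"
    by (auto simp: r d q_def eval_nat_numeral simp del: mult_Suc intro!: achieves_bind_step)
qed

end

section \<open>Transfer to vectors and the running time\<close>

theorem corollary34:
  shows "\<exists>C::nat. \<forall>(m::nat) (n::nat) (A::real mat) (b::real vec).
    lp_instance m n A b (ones_vec n) \<longrightarrow>
    mu_transitive (Sym_ILP A b (ones_vec n)) (standard_basis n) (basis_action n) (n div 2 + 1) \<longrightarrow>
      (\<exists>\<zeta>. result_of (symmetric_lp_solution A b) = Some \<zeta> \<and>
           lp_optimal A b (ones_vec n) (\<zeta> \<cdot>\<^sub>v ones_vec n) \<and>
           (\<forall>\<gamma>\<in>carrier (Sym_ILP A b (ones_vec n)).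
              \<gamma> *\<^sub>v (\<zeta> \<cdot>\<^sub>v ones_vec n) = \<zeta> \<cdot>\<^sub>v ones_vec n)) \<and>
      (if ilp_feasible A b \<noteq> {}
       then \<exists>x. result_of (core_point_algorithm A b) = Some x \<and>
                ilp_optimal A b (ones_vec n) x
       else result_of (core_point_algorithm A b) = None) \<and>
      steps_of (core_point_algorithm A b) \<le> C * m * n\<^sup>2"
\<comment> \<open>35 is the sum of the coefficients 5, 8, 7, 4, 4 and 7 of the expanded step bound;
  each of its monomials is at most \<open>m * n * n\<close> because \<open>m\<close> and
  \<open>n\<close> are positive.\<close>
proof (rule exI[of _ 35], intro allI impI conjI)
  fix m n :: nat and A :: "real mat" and b :: "real vec"
  assume inst: "lp_instance m n A b (ones_vec n)"
    and trans: "mu_transitive (Sym_ILP A b (ones_vec n)) (standard_basis n) (basis_action n) (n div 2 + 1)"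
  interpret highly_transitive A b using inst trans by (rule highly_transitive_Sym_ILP)
  have n: "dim_col A = n" and m: "dim_row A = m" and dim: "dim_vec b = dim_row A"
    using inst by (auto simp: lp_instance_def)
  obtain x\<^sub>0 where x\<^sub>0: "lp_optimal A b (ones_vec n) x\<^sub>0" using inst by (auto simp: lp_instance_def)
  then have ne: "solution_set A b \<noteq> {}"
    using polyhedron_of_iff[OF dim] by (auto simp: lp_optimal_def maximizer_def)
  have bound: "(\<Sum>j<dim_col A. x j) \<le> ones_vec n \<bullet> x\<^sub>0" if "x \<in> solution_set A b" for x
  proof -
    have "vec n x \<in> polyhedron_of A b" using that vec_in_polyhedron_of_iff[OF dim] n by simp
    then have "ones_vec n \<bullet> vec n x \<le> ones_vec n \<bullet> x\<^sub>0"
      using x\<^sub>0 by (auto simp: lp_optimal_def maximizer_def)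
    then show ?thesis by (simp add: ones_vec_scalar_prod n)
  qed
  \<comment> \<open>Without constraints, large multiples of the all-ones vector would exceed the
    optimum.\<close>
  have m_pos: "m > 0"
  proof (rule ccontr)
    assume "\<not> m > 0"
    then have "(\<lambda>_. ones_vec n \<bullet> x\<^sub>0 / n + 1) \<in> solution_set A b" by (simp add: solution_set_def m)
    from bound[OF this] show False using dim_pos by (simp add: n distrib_left)
  qed
  have feasible_iff: "x \<in> ilp_feasible A b \<longleftrightarrow>
      (\<exists>y::nat \<Rightarrow> int. x = vec n (\<lambda>j. of_int (y j)) \<and> (\<lambda>j. of_int (y j)) \<in> solution_set A b)" for x
  proof
    assume x: "x \<in> ilp_feasible A b"
    \<comment> \<open>On integral coordinates the floor changes nothing and supplies the
      integer-valued function.\<close>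
    then have "x = vec n (\<lambda>j. of_int \<lfloor>x $ j\<rfloor>)"
      by (auto simp: ilp_feasible_def integer_vecs_def n elim!: Ints_cases)
    moreover from this have "(\<lambda>j. of_int \<lfloor>x $ j\<rfloor>) \<in> solution_set A b"
      using x vec_in_polyhedron_of_iff[OF dim] n by (metis IntD1 ilp_feasible_def)
    ultimately show "\<exists>y::nat \<Rightarrow> int. x = vec n (\<lambda>j. of_int (y j)) \<and> (\<lambda>j. of_int (y j)) \<in> solution_set A b"
      by (intro exI[of _ "\<lambda>j. \<lfloor>x $ j\<rfloor>"]) simp
  qed (use vec_in_polyhedron_of_iff[OF dim] n in \<open>auto simp: ilp_feasible_def integer_vecs_def\<close>)
  have objective: "ones_vec n \<bullet> vec n (\<lambda>j. of_int (y j)) = of_int (\<Sum>j<n. y j)" for y :: "nat \<Rightarrow> int"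
    by (simp add: ones_vec_scalar_prod)

  obtain \<zeta> where \<zeta>: "result_of (symmetric_lp_solution A b) = Some \<zeta>" "(\<lambda>_. \<zeta>) \<in> solution_set A b"
      "\<forall>x\<in>solution_set A b. (\<Sum>j<n. x j) \<le> real n * \<zeta>"
    using achieves_result[OF symmetric_lp_solution_optimal[OF ne bound]] n by auto
  have z: "\<zeta> \<cdot>\<^sub>v ones_vec n = vec n (\<lambda>_. \<zeta>)" by (auto simp: ones_vec_def)
  have "lp_optimal A b (ones_vec n) (\<zeta> \<cdot>\<^sub>v ones_vec n)"
    unfolding lp_optimal_def maximizer_def z
  proof (intro conjI ballI)
    show "vec n (\<lambda>_. \<zeta>) \<in> polyhedron_of A b" using \<zeta> vec_in_polyhedron_of_iff[OF dim] n by simp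
    fix y assume "y \<in> polyhedron_of A b"
    then have "y \<in> carrier_vec n" "($) y \<in> solution_set A b" using polyhedron_of_iff[OF dim] n by auto
    then show "ones_vec n \<bullet> y \<le> ones_vec n \<bullet> vec n (\<lambda>_. \<zeta>)"
      using \<zeta>(3) by (simp add: ones_vec_scalar_prod)
  qed
  \<comment> \<open>Symmetries permute the coordinates and therefore fix constant vectors, so the
    computed optimum is a symmetric one.\<close>
  moreover have "\<gamma> *\<^sub>v (\<zeta> \<cdot>\<^sub>v ones_vec n) = \<zeta> \<cdot>\<^sub>v ones_vec n"
    if "\<gamma> \<in> carrier (Sym_ILP A b (ones_vec n))" for \<gamma>
  proof -
    have "group_action (Sym_ILP A b (ones_vec n)) (standard_basis (dim_col A)) (basis_action (dim_col A))"
      using trans by (simp add: mu_transitive_def n)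
    from symmetry_permutation[OF this that] obtain \<pi> where \<pi>: "\<pi> permutes {..<n}"
        "\<And>x. x \<in> carrier_vec n \<Longrightarrow> \<gamma> *\<^sub>v x = vec n (($) x \<circ> inv_into UNIV \<pi>)"
      by (auto simp: n)
    have "inv_into UNIV \<pi> k < n" if "k < n" for k
      using permutes_in_image[OF permutes_inv[OF \<pi>(1)], of k] that by simp
    moreover have "\<gamma> *\<^sub>v vec n (\<lambda>_. \<zeta>) = vec n (($) (vec n (\<lambda>_. \<zeta>)) \<circ> inv_into UNIV \<pi>)"
      by (rule \<pi>(2)) simp
    ultimately show ?thesis unfolding z by (intro eq_vecI) simp_all
  qed
  ultimately show "\<exists>\<zeta>. result_of (symmetric_lp_solution A b) = Some \<zeta> \<and>
           lp_optimal A b (ones_vec n) (\<zeta> \<cdot>\<^sub>v ones_vec n) \<and>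
           (\<forall>\<gamma>\<in>carrier (Sym_ILP A b (ones_vec n)).
              \<gamma> *\<^sub>v (\<zeta> \<cdot>\<^sub>v ones_vec n) = \<zeta> \<cdot>\<^sub>v ones_vec n)"
    using \<zeta>(1) by blast

  note result = achieves_result[OF core_point_algorithm_achieves[OF ne bound], unfolded n]
  show "if ilp_feasible A b \<noteq> {}
       then \<exists>x. result_of (core_point_algorithm A b) = Some x \<and> ilp_optimal A b (ones_vec n) x
       else result_of (core_point_algorithm A b) = None"
  proof (cases "result_of (core_point_algorithm A b)")
    case None
    then have "ilp_feasible A b = {}" using result feasible_iff by auto
    then show ?thesis using None by simp
  next
    case (Some x)
    then obtain z :: "nat \<Rightarrow> int" where z: "x = vec n (\<lambda>j. of_int (z j))"
      "(\<lambda>j. of_int (z j)) \<in> solution_set A b"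
      "\<And>y. (\<lambda>j. of_int (y j)) \<in> solution_set A b \<Longrightarrow> (\<Sum>j<n. y j) \<le> (\<Sum>j<n. z j)"
      using result by auto
    then have x: "x \<in> ilp_feasible A b" using feasible_iff by auto
    moreover have "ones_vec n \<bullet> y \<le> ones_vec n \<bullet> x" if "y \<in> ilp_feasible A b" for y
      using that z(3) unfolding feasible_iff z(1) by (auto simp only: objective of_int_le_iff)
    ultimately have "ilp_optimal A b (ones_vec n) x" by (simp add: ilp_optimal_def maximizer_def)
    then show ?thesis using Some x by auto
  qed

  have "steps_of (core_point_algorithm A b)
      \<le> m * (3 * n + 7) + 1 + (6 + n * (4 * n + m * (5 * n + 5) + 4))"
    using achieves_steps[OF core_point_algorithm_achieves[OF ne bound]] by (simp add: n m)
  also have "\<dots> = 5 * (m * n * n) + 8 * (m * n) + 7 * m + 4 * (n * n) + 4 * n + 7"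
    by (simp add: algebra_simps)
  also have "\<dots> \<le> 35 * (m * n * n)"
  proof -
    have "n \<le> n * n" "n * n \<le> m * n * n" "m * n \<le> m * n * n" "m \<le> m * n" "1 \<le> n"
      using m_pos dim_pos n by auto
    then show ?thesis by linarith
  qed
  finally show "steps_of (core_point_algorithm A b) \<le> 35 * m * n\<^sup>2"
    by (simp add: power2_eq_square mult.assoc)
qed

end
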